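(* Let $n\in\mathbb N$ and let $F\in H(T_\Omega)$. Then the following statements are equivalent. (i) $F\in H^n_{2,\rho}(T_\Omega)$. (ii) There exists a unique function $f\in L^2(\Omega^\ast,w_n)$ such that $$F(z)=\int_{\Omega^\ast}e^{i\langle z,\xi\rangle}f(\xi)\,d\xi,\qquad z\in T_\Omega.$$ (iii) There exists a unique function $f\in L^2(\Omega^\ast,w_n)$ such that, for every $y\in\Omega$, one has $F_y\in L^2(\mathbb R^d)$ and $$\widehat{F_y}(\xi)=e^{-\langle y,\xi\rangle}f(\xi)\chi_{\Omega^\ast}(\xi)\qquad\text{for a.e. }\xi\in\mathbb R^d.$$ Moreover, whenever these conditions hold, with $f$ the function in (ii) and (iii), one has $$\|F\|_{H^n_{2,\rho}(T_\Omega)}=\|f\|_{L^2(\Omega^\ast,w_n)}.$$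
   Context: Let $d\ge 1$ and let $\Omega\subset\mathbb R^d$ be a nonempty open convex cone containing no complete straight line. Its dual cone is $\Omega^\ast=\{\xi\in\mathbb R^d:\langle x,\xi\rangle\ge 0\text{ for all }x\in\Omega\}$, and $T_\Omega=\mathbb R^d+i\Omega\subset\mathbb C^d$ is the associated tube domain; $H(T_\Omega)$ is the space of holomorphic functions on $T_\Omega$. For $z\in\mathbb C^d$, $\xi\in\mathbb R^d$, $\langle z,\xi\rangle=\sum_{j=1}^d z_j\xi_j$ (bilinear). $\chi_E$ is the indicator function of $E$ (and $f\chi_{\Omega^\ast}$ is extended by $0$ off $\Omega^\ast$). Fix a continuous function $\rho:\Omega^\ast\to[0,\infty)$ with $\rho(\xi)>0$ for $\xi\ne 0$ and $\rho(t\xi)=t\rho(\xi)$ for all $t>0$, $\xi\in\Omega^\ast$ (so $\rho(0)=0$). For $n\in\mathbb N$ let $w_n(\xi)=\sum_{k=0}^n\rho(\xi)^{2k}$, and let $L^2(\Omega^\ast,w_n)$ be the space of (classes of) measurable complex functions $f$ on $\Omega^\ast$ with $\|f\|_{L^2(\Omega^\ast,w_n)}^2=\int_{\Omega^\ast}|f(\xi)|^2w_n(\xi)\,d\xi<\infty$. The Hilbertian Hardy--Sobolev space $H^n_{2,\rho}(T_\Omega)$ consists of all holomorphic functions $F$ on $T_\Omega$ of the form $F=\mathcal Lf$, where $\mathcal Lf(z)=\int_{\Omega^\ast}e^{i\langle z,\xi\rangle}f(\xi)\,d\xi$, for some $f\in L^2(\Omega^\ast,w_n)$, with norm $\|F\|_{H^n_{2,\rho}(T_\Omega)}=\inf\{\|f\|_{L^2(\Omega^\ast,w_n)}:F=\mathcal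 Lf\}$. For $F\in H(T_\Omega)$ and $y\in\Omega$, $F_y(x):=F(x+iy)$, $x\in\mathbb R^d$. The Fourier transform is $\widehat u(\xi)=(2\pi)^{-d}\int_{\mathbb R^d}u(x)e^{-i\langle x,\xi\rangle}\,dx$ for $u\in L^1(\mathbb R^d)$, extended as usual to $L^2(\mathbb R^d)$; thus the inversion formula is $u(x)=\int_{\mathbb R^d}\widehat u(\xi)e^{i\langle x,\xi\rangle}\,d\xi$. *)

theory Defs
  imports "HOL-Analysis.Analysis"
begin

text \<open>The library's \<open>cone\<close> also asks for closure under multiplication by \<open>0\<close>, which
  a nonempty open cone satisfies only if it is the whole space; so scalars are strictly positive here.\<close>

definition regular_open_cone :: "(real^'d) set \<Rightarrow> bool" where
  "regular_open_cone \<Omega> \<longleftrightarrow>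
     \<Omega> \<noteq> {} \<and> open \<Omega> \<and> convex \<Omega> \<and>
     (\<forall>x\<in>\<Omega>. \<forall>t>0. t *\<^sub>R x \<in> \<Omega>) \<and>
     (\<nexists>a v. v \<noteq> 0 \<and> (\<forall>t. a + t *\<^sub>R v \<in> \<Omega>))"

definition dual_cone :: "(real^'d) set \<Rightarrow> (real^'d) set" where
  "dual_cone \<Omega> = {\<xi>. \<forall>x\<in>\<Omega>. x \<bullet> \<xi> \<ge> 0}"

definition cvec :: "real^'d \<Rightarrow> real^'d \<Rightarrow> complex^'d" where
  "cvec x y = (\<chi> j. Complex (x $ j) (y $ j))"

definition tube :: "(real^'d) set \<Rightarrow> (complex^'d) set" where
  "tube \<Omega> = {cvec x y | x y. y \<in> \<Omega>}"

text \<open>Complex bilinear; the library inner product on \<open>complex^'d\<close> is real valued.\<close>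

definition cpair :: "complex^'d \<Rightarrow> real^'d \<Rightarrow> complex" where
  "cpair z \<xi> = (\<Sum>j\<in>UNIV. z $ j * of_real (\<xi> $ j))"

text \<open>Holomorphy in several variables on an open set: the real Frechet derivative exists at
  every point and is complex linear.\<close>

definition holomorphic_several_on :: "(complex^'d \<Rightarrow> complex) \<Rightarrow> (complex^'d) set \<Rightarrow> bool" where
  "holomorphic_several_on F G \<longleftrightarrow>
     (\<forall>z\<in>G. \<exists>a :: complex^'d. (F has_derivative (\<lambda>h. \<Sum>j\<in>UNIV. a $ j * h $ j)) (at z))"

text \<open>Functions rather than classes; classes enter through almost everywhere equality.\<close>

definition wL2 :: "'a measure \<Rightarrow> ('a \<Rightarrow> real) \<Rightarrow> ('a \<Rightarrow> complex) set" where
  "wL2 M w = {f \<in> borel_measurable M. integrable M (\<lambda>x. (cmod (f x))\<^sup>2 * w x)}"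

definition wL2_norm :: "'a measure \<Rightarrow> ('a \<Rightarrow> real) \<Rightarrow> ('a \<Rightarrow> complex) \<Rightarrow> real" where
  "wL2_norm M w f = sqrt (LINT x|M. (cmod (f x))\<^sup>2 * w x)"

definition ex1_AE :: "'a measure \<Rightarrow> ('a \<Rightarrow> complex) set \<Rightarrow> (('a \<Rightarrow> complex) \<Rightarrow> bool) \<Rightarrow> bool" where
  "ex1_AE M A P \<longleftrightarrow>
     (\<exists>f\<in>A. P f \<and> (\<forall>g\<in>A. P g \<longrightarrow> (AE x in M. g x = f x)))"

text \<open>In \<open>sob_weight\<close> the term \<open>k = 0\<close> is \<open>1\<close> everywhere.\<close>

definition sob_weight :: "(real^'d \<Rightarrow> real) \<Rightarrow> nat \<Rightarrow> real^'d \<Rightarrow> real" where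
  "sob_weight \<rho> n \<xi> = (\<Sum>k=0..n. \<rho> \<xi> ^ (2 * k))"

definition L2_weight :: "(real^'d) set \<Rightarrow> (real^'d \<Rightarrow> real) \<Rightarrow> nat \<Rightarrow> (real^'d \<Rightarrow> complex) set" where
  "L2_weight \<Omega> \<rho> n = wL2 (lebesgue_on (dual_cone \<Omega>)) (sob_weight \<rho> n)"

definition L2_weight_norm :: "(real^'d) set \<Rightarrow> (real^'d \<Rightarrow> real) \<Rightarrow> nat \<Rightarrow> (real^'d \<Rightarrow> complex) \<Rightarrow> real" where
  "L2_weight_norm \<Omega> \<rho> n = wL2_norm (lebesgue_on (dual_cone \<Omega>)) (sob_weight \<rho> n)"

definition L2_space :: "(real^'d \<Rightarrow> complex) set" where
  "L2_space = wL2 lebesgue (\<lambda>_. 1)"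

definition laplace :: "(real^'d) set \<Rightarrow> (real^'d \<Rightarrow> complex) \<Rightarrow> complex^'d \<Rightarrow> complex" where
  "laplace \<Omega> f z = (LINT \<xi>|lebesgue_on (dual_cone \<Omega>). exp (\<i> * cpair z \<xi>) * f \<xi>)"

text \<open>Only the values of \<open>F\<close> on the tube matter.\<close>

definition hardy_sobolev :: "(real^'d) set \<Rightarrow> (real^'d \<Rightarrow> real) \<Rightarrow> nat \<Rightarrow> (complex^'d \<Rightarrow> complex) set" where
  "hardy_sobolev \<Omega> \<rho> n =
     {F. holomorphic_several_on F (tube \<Omega>) \<and>
         (\<exists>f\<in>L2_weight \<Omega> \<rho> n. \<forall>z\<in>tube \<Omega>. F z = laplace \<Omega> f z)}"

definition hardy_sobolev_norm ::
    "(real^'d) set \<Rightarrow> (real^'d \<Rightarrow> real) \<Rightarrow> nat \<Rightarrow> (complex^'d \<Rightarrow> complex) \<Rightarrow> real" where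
  "hardy_sobolev_norm \<Omega> \<rho> n F =
     Inf {L2_weight_norm \<Omega> \<rho> n f | f.
            f \<in> L2_weight \<Omega> \<rho> n \<and> (\<forall>z\<in>tube \<Omega>. F z = laplace \<Omega> f z)}"

definition slice :: "(complex^'d \<Rightarrow> complex) \<Rightarrow> real^'d \<Rightarrow> real^'d \<Rightarrow> complex" where
  "slice F y x = F (cvec x y)"

definition fourier_L1 :: "(real^'d \<Rightarrow> complex) \<Rightarrow> real^'d \<Rightarrow> complex" where
  "fourier_L1 u \<xi> =
     of_real (1 / (2 * pi) ^ CARD('d)) * (LINT x|lebesgue. u x * exp (- (\<i> * of_real (x \<bullet> \<xi>))))"

text \<open>The squared distance is a nonnegative extended integral, so that tending to \<open>0\<close>
  cannot hold by a failure of integrability.\<close>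

definition tendsto_L2 :: "(nat \<Rightarrow> real^'d \<Rightarrow> complex) \<Rightarrow> (real^'d \<Rightarrow> complex) \<Rightarrow> bool" where
  "tendsto_L2 u v \<longleftrightarrow>
     (\<lambda>k. \<integral>\<^sup>+x. ennreal ((cmod (u k x - v x))\<^sup>2) \<partial>lebesgue) \<longlonglongrightarrow> 0"

text \<open>The extension of \<^const>\<open>fourier_L1\<close> to square integrable functions by continuity from
  those that are also integrable. The value is determined up to a null set.\<close>

definition has_fourier_L2 :: "(real^'d \<Rightarrow> complex) \<Rightarrow> (real^'d \<Rightarrow> complex) \<Rightarrow> bool" where
  "has_fourier_L2 u g \<longleftrightarrow> u \<in> L2_space \<and> g \<in> L2_space \<and>
     (\<exists>v. (\<forall>k. integrable lebesgue (v k) \<and> v k \<in> L2_space) \<and>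
          tendsto_L2 v u \<and> tendsto_L2 (\<lambda>k. fourier_L1 (v k)) g)"

definition fourier_L2 :: "(real^'d \<Rightarrow> complex) \<Rightarrow> real^'d \<Rightarrow> complex" where
  "fourier_L2 u = (SOME g. has_fourier_L2 u g)"

definition laplace_rep :: "(real^'d) set \<Rightarrow> (complex^'d \<Rightarrow> complex) \<Rightarrow> (real^'d \<Rightarrow> complex) \<Rightarrow> bool" where
  "laplace_rep \<Omega> F f \<longleftrightarrow> (\<forall>z\<in>tube \<Omega>. F z = laplace \<Omega> f z)"

definition fourier_rep :: "(real^'d) set \<Rightarrow> (complex^'d \<Rightarrow> complex) \<Rightarrow> (real^'d \<Rightarrow> complex) \<Rightarrow> bool" where
  "fourier_rep \<Omega> F f \<longleftrightarrow>
     (\<forall>y\<in>\<Omega>. slice F y \<in> L2_space \<and>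
        (AE \<xi> in lebesgue. fourier_L2 (slice F y) \<xi> =
            of_real (exp (- (y \<bullet> \<xi>))) * f \<xi> * indicator (dual_cone \<Omega>) \<xi>))"

end

theory Submission
  imports Defs "HOL-Probability.Probability"
begin

text \<open>
Writing \<open>z = x + \<i>y\<close> turns \<open>exp (\<i>\<langle>z,\<xi>\<rangle>)\<close> into \<open>exp (\<i>\<langle>x,\<xi>\<rangle>) exp (-\<langle>y,\<xi>\<rangle>)\<close>. So on the slice at
height \<open>y\<close> the Laplace integral of \<open>f\<close> is the (inverse) Fourier integral of the damped function
\<open>f\<^sub>y = exp (-\<langle>y,\<cdot>\<rangle>) f \<chi>\<close>, with \<open>\<chi>\<close> the indicator of the dual cone (\<open>laplace_eq_osc_int\<close>). The
weight is at least \<open>1\<close>, so \<open>f\<close> is square integrable; and since \<open>y\<close> is an interior point of the cone,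
\<open>\<langle>y,\<xi>\<rangle> \<ge> c |\<xi>|\<close> on the dual cone (\<open>dual_cone_coercive\<close>). Hence \<open>f\<^sub>y\<close> is both integrable and square
integrable. The equivalence of the two representations is then a statement about a single
continuous function \<open>u\<close> and a single \<open>h\<close> in \<open>L\<^sup>1 \<inter> L\<^sup>2\<close>: the function \<open>u\<close> lies in \<open>L\<^sup>2\<close> with Fourier
transform \<open>h\<close> if and only if \<open>u(x) = \<integral> h(\<xi>) exp (\<i>\<langle>x,\<xi>\<rangle>) d\<xi>\<close> everywhere
(\<open>fourier_L2_eq_iff_eq_osc_int\<close>). The slices of the holomorphic function \<open>F\<close> are continuous, which
upgrades an almost everywhere identity to an identity. Uniqueness is clear on the Fourier side,
because the damping factor never vanishes, and the infimum in the norm of \<open>F\<close> then runs over one value.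

The fact about \<open>u\<close> and \<open>h\<close> is a form of the Plancherel theorem on \<open>R\<^sup>d\<close>. Everything is reduced to
Gaussians, whose transform is known explicitly.

\<^item> Integrating the Fourier integral of \<open>g\<close> against a Gaussian gives \<open>g\<close> convolved with a Gaussian
  (\<open>osc_int_gauss_summability\<close>). If the Fourier integral vanishes, so do all these convolutions, and
  letting them concentrate shows that \<open>g = 0\<close> (\<open>osc_int_eq_0_imp_AE_eq_0\<close>).

\<^item> The same identity makes the Gaussian-regularised energy of the Fourier integral a quadratic form in
  \<open>g\<close> with a Gaussian kernel, which the inequality of the arithmetic and geometric means bounds by
  \<open>(2\<pi>)\<^sup>d\<close> times the squared norm of \<open>g\<close>. Removing the regularisation gives the inequality
  \<open>osc_int_bessel\<close>. This half of the Plancherel identity is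
  enough: with the completeness of \<open>L\<^sup>2\<close> it makes the transform of every square integrable function
  exist (\<open>ex_has_fourier_L2\<close>).

\<^item> An \<open>L\<^sup>2\<close> transform \<open>G\<close> of \<open>u\<close> satisfies \<open>\<integral> G \<phi> = \<integral> u \<phi>^\<close> for every \<open>\<phi>\<close> in \<open>L\<^sup>1 \<inter> L\<^sup>2\<close>, where \<open>\<phi>^\<close> is the
  transform of \<open>\<phi>\<close>. For modulated Gaussians \<open>\<phi>\<close> the Fourier integral of \<open>h\<close> satisfies the same relation
  with \<open>h\<close> in place of \<open>G\<close>. These test functions separate points of \<open>L\<^sup>2\<close>, by the injectivity result
  above, so comparing the two relations identifies \<open>G\<close> with \<open>h\<close> (given \<open>u\<close>) or \<open>u\<close> with the Fourier
  integral of \<open>h\<close> (given \<open>G = h\<close>).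
\<close>

section \<open>Gaussians and their Fourier integrals\<close>

text \<open>The parameter is the inverse width, so that the Fourier transform replaces \<open>t\<close> by \<open>1 / t\<close>.\<close>

definition gauss :: "real \<Rightarrow> 'a::euclidean_space \<Rightarrow> real" where
  "gauss t x = exp (- (t\<^sup>2 * (x \<bullet> x) / 2))"

text \<open>The inverse Fourier transform, in the normalisation without a constant in front.\<close>

definition osc_int :: "('a::euclidean_space \<Rightarrow> complex) \<Rightarrow> 'a \<Rightarrow> complex" where
  "osc_int g x = (LINT \<xi>|lebesgue. g \<xi> * exp (\<i> * of_real (x \<bullet> \<xi>)))"

text \<open>Lebesgue measure on a Euclidean space is the image of the product measure over the coordinates, so
  integrals of products of one-dimensional functions factor. This carries the one-dimensional
  Gaussian integral, and later the integrability of exponentials, to higher dimensions.\<close>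

lemma
  fixes f :: "'a::euclidean_space \<Rightarrow> real \<Rightarrow> complex"
  assumes "\<And>b. b \<in> Basis \<Longrightarrow> integrable lborel (f b)"
  shows integrable_prod_Basis: "integrable lborel (\<lambda>x::'a. \<Prod>b\<in>Basis. f b (x \<bullet> b))"
    and integral_prod_Basis:
      "(LINT x|(lborel :: 'a measure). (\<Prod>b\<in>Basis. f b (x \<bullet> b))) = (\<Prod>b\<in>Basis. (LINT x|lborel. f b x))"
proof -
  interpret product_sigma_finite "\<lambda>_::'a. lborel :: real measure"
    by standard
  define T :: "('a \<Rightarrow> real) \<Rightarrow> 'a" where "T g = (\<Sum>b\<in>Basis. g b *\<^sub>R b)" for g
  have T[measurable]: "T \<in> (\<Pi>\<^sub>M b\<in>Basis. lborel) \<rightarrow>\<^sub>M borel"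
    unfolding T_def by measurable
  have [measurable]: "f b \<in> borel_measurable borel" if "b \<in> Basis" for b
    using borel_measurable_integrable[OF assms[OF that]] by simp
  have m: "(\<lambda>x::'a. \<Prod>b\<in>Basis. f b (x \<bullet> b)) \<in> borel_measurable borel"
    by measurable
  have eq: "lborel = distr (\<Pi>\<^sub>M b\<in>Basis. lborel) borel T"
    unfolding T_def by (rule lborel_eq)
  have T_b: "(\<Prod>b\<in>Basis. f b (T g \<bullet> b)) = (\<Prod>b\<in>Basis. f b (g b))" for g
    by (intro prod.cong refl) (simp add: T_def inner_sum_left inner_Basis if_distrib sum.If_cases cong: if_cong)
  show "integrable lborel (\<lambda>x::'a. \<Prod>b\<in>Basis. f b (x \<bullet> b))"
    by (subst eq, subst integrable_distr_eq[OF T m])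
       (simp add: T_b product_integrable_prod assms)
  show "(LINT x|(lborel :: 'a measure). (\<Prod>b\<in>Basis. f b (x \<bullet> b))) = (\<Prod>b\<in>Basis. (LINT x|lborel. f b x))"
    by (subst eq, subst integral_distr[OF T m])
       (simp add: T_b product_integral_prod assms)
qed

text \<open>A rescaled form of the characteristic function of the standard normal distribution.\<close>

lemma
  fixes s t :: real
  assumes t: "t > 0"
  shows integrable_gauss_real: "integrable lborel (\<lambda>x. exp (- (of_real t * of_real x)\<^sup>2 / 2) * exp (\<i> * of_real (x * s)))"
    and integral_gauss_real: "(LINT x|lborel. exp (- (of_real t * of_real x)\<^sup>2 / 2) * exp (\<i> * of_real (x * s)))
          = of_real (sqrt (2 * pi) / t * exp (- (s / t)\<^sup>2 / 2))"
proof -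
  define h where "h = (\<lambda>x::real. exp (- (of_real x)\<^sup>2 / 2) * exp (\<i> * of_real (x * (s / t))) :: complex)"
  have den: "std_normal_density x *\<^sub>R iexp (s / t * x) = of_real (1 / sqrt (2 * pi)) * h x" for x
    unfolding h_def std_normal_density_def
    by (simp add: scaleR_conv_of_real mult_ac exp_of_real[symmetric])
  have "integrable lborel (\<lambda>x. std_normal_density x *\<^sub>R iexp (s / t * x))"
    by (rule Bochner_Integration.integrable_bound[where f = std_normal_density])
       (auto simp: norm_mult normal_density_nonneg)
  then have "integrable lborel (\<lambda>x. of_real (sqrt (2 * pi)) * (std_normal_density x *\<^sub>R iexp (s / t * x)))"
    by (rule integrable_mult_right)
  then have int_h: "integrable lborel h"
    unfolding den mult.assoc[symmetric] of_real_mult[symmetric] by simp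
  have "complex_of_real (exp (- (s / t)\<^sup>2 / 2)) = char std_normal_distribution (s / t)"
    by (simp add: char_std_normal_distribution)
  also have "\<dots> = (LINT x|lborel. std_normal_density x *\<^sub>R iexp (s / t * x))"
    unfolding char_def by (subst integral_density) (auto simp: normal_density_nonneg)
  also have "\<dots> = of_real (1 / sqrt (2 * pi)) * (LINT x|lborel. h x)"
    unfolding den by simp
  finally have I: "(LINT x|lborel. h x) = of_real (sqrt (2 * pi) * exp (- (s / t)\<^sup>2 / 2))"
    by (simp add: field_simps)
  have sub: "exp (- (of_real t * of_real x)\<^sup>2 / 2) * exp (\<i> * of_real (x * s)) = h (0 + t * x)" for x
    using t unfolding h_def by simp
  show "integrable lborel (\<lambda>x. exp (- (of_real t * of_real x)\<^sup>2 / 2) * exp (\<i> * of_real (x * s)))"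
    unfolding sub by (rule lborel_integrable_real_affine[OF int_h]) (use t in simp)
  have "(LINT x|lborel. h x) = \<bar>t\<bar> *\<^sub>R (LINT x|lborel. h (0 + t * x))"
    by (rule lborel_integral_real_affine) (use t in simp)
  then show "(LINT x|lborel. exp (- (of_real t * of_real x)\<^sup>2 / 2) * exp (\<i> * of_real (x * s)))
          = of_real (sqrt (2 * pi) / t * exp (- (s / t)\<^sup>2 / 2))"
    unfolding sub I using t by (simp add: scaleR_conv_of_real field_simps)
qed

lemma continuous_on_gauss [continuous_intros]:
  "continuous_on S f \<Longrightarrow> continuous_on S (\<lambda>x. gauss t (f x))"
  unfolding gauss_def by (intro continuous_intros) auto

lemma borel_measurable_gauss [measurable]: "gauss t \<in> borel_measurable borel"
  unfolding gauss_def by measurable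

lemma gauss_pos [simp]: "gauss t x > 0" and gauss_le_1 [simp]: "gauss t x \<le> 1"
  and gauss_minus [simp]: "gauss t (- x) = gauss t x"
  by (auto simp: gauss_def)

lemma gauss_nonneg [simp]: "gauss t x \<ge> 0"
  using gauss_pos[of t x] by linarith

lemma gauss_minus_commute: "gauss t (x - y) = gauss t (y - x)"
  using gauss_minus[of t "x - y"] by simp

lemma
  fixes \<xi> :: "'a::euclidean_space"
  assumes t: "t > 0"
  shows integrable_gauss_exp: "integrable lebesgue (\<lambda>x. of_real (gauss t x) * exp (\<i> * of_real (x \<bullet> \<xi>)))"
    and integral_gauss_exp: "(LINT x|lebesgue. of_real (gauss t x) * exp (\<i> * of_real (x \<bullet> \<xi>)))
          = of_real ((sqrt (2 * pi) / t) ^ DIM('a) * gauss (1 / t) \<xi>)"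
proof -
  define f :: "'a \<Rightarrow> real \<Rightarrow> complex" where
    "f b x = exp (- (of_real t * of_real x)\<^sup>2 / 2) * exp (\<i> * of_real (x * (\<xi> \<bullet> b)))" for b x
  have f: "integrable lborel (f b)" for b
    unfolding f_def by (rule integrable_gauss_real[OF t])
  have prod: "of_real (gauss t x) * exp (\<i> * of_real (x \<bullet> \<xi>)) = (\<Prod>b\<in>Basis. f b (x \<bullet> b))" for x
  proof -
    have "(\<Prod>b\<in>Basis. f b (x \<bullet> b)) = exp (\<Sum>b\<in>Basis. - (of_real t * of_real (x \<bullet> b))\<^sup>2 / 2) * 
       exp (\<Sum>b\<in>Basis. \<i> * of_real ((x \<bullet> b) * (\<xi> \<bullet> b)))"
      unfolding f_def prod.distrib by (simp add: exp_sum)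
    also have "(\<Sum>b\<in>Basis. - (of_real t * of_real (x \<bullet> b))\<^sup>2 / 2) = complex_of_real (- (t\<^sup>2 * (x \<bullet> x) / 2))"
      by (subst euclidean_inner[of x x])
         (simp add: power2_eq_square sum_distrib_left sum_divide_distrib sum_negf[symmetric] mult_ac)
    also have "(\<Sum>b\<in>Basis. \<i> * of_real ((x \<bullet> b) * (\<xi> \<bullet> b))) = \<i> * complex_of_real (x \<bullet> \<xi>)"
      by (subst euclidean_inner[of x \<xi>]) (simp add: sum_distrib_left)
    finally show ?thesis
      unfolding gauss_def by (simp only: exp_of_real)
  qed
  have m: "(\<lambda>x::'a. \<Prod>b\<in>Basis. f b (x \<bullet> b)) \<in> borel_measurable lborel"
    unfolding f_def by measurable
  show "integrable lebesgue (\<lambda>x. of_real (gauss t x) * exp (\<i> * of_real (x \<bullet> \<xi>)))"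
    unfolding prod using integrable_prod_Basis[of f] f integrable_completion[OF m] by simp
  have "(LINT x|lebesgue. of_real (gauss t x) * exp (\<i> * of_real (x \<bullet> \<xi>))) = (\<Prod>b\<in>Basis. (LINT x|lborel. f b x))"
    unfolding prod integral_completion[OF m] by (rule integral_prod_Basis[OF f])
  also have "\<dots> = (\<Prod>b\<in>Basis. of_real (sqrt (2 * pi) / t * exp (- ((\<xi> \<bullet> b) / t)\<^sup>2 / 2)))"
    unfolding f_def integral_gauss_real[OF t] by (rule refl)
  also have "\<dots> = of_real ((sqrt (2 * pi) / t) ^ DIM('a) * exp (\<Sum>b\<in>Basis. - ((\<xi> \<bullet> b) / t)\<^sup>2 / 2))"
    by (simp only: of_real_prod[symmetric] prod.distrib prod_constant exp_sum[OF finite_Basis])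
  also have "(\<Sum>b\<in>Basis. - ((\<xi> \<bullet> b) / t)\<^sup>2 / 2) = - ((1 / t)\<^sup>2 * (\<xi> \<bullet> \<xi>) / 2)"
    by (subst euclidean_inner[of \<xi> \<xi>])
       (simp add: power2_eq_square sum_distrib_left sum_divide_distrib sum_negf[symmetric] mult_ac)
  finally show "(LINT x|lebesgue. of_real (gauss t x) * exp (\<i> * of_real (x \<bullet> \<xi>)))
          = of_real ((sqrt (2 * pi) / t) ^ DIM('a) * gauss (1 / t) \<xi>)"
    unfolding gauss_def .
qed

lemma
  assumes t: "t > 0"
  shows integrable_gauss: "integrable lebesgue (gauss t :: 'a::euclidean_space \<Rightarrow> real)"
    and integral_gauss: "(LINT x|lebesgue. gauss t (x::'a)) = (sqrt (2 * pi) / t) ^ DIM('a)"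
proof -
  have "integrable lebesgue (\<lambda>x::'a. complex_of_real (gauss t x))"
    using integrable_gauss_exp[OF t, of "0::'a"] by simp
  then show i: "integrable lebesgue (gauss t :: 'a \<Rightarrow> real)"
    using integrable_Re by fastforce
  have "complex_of_real (LINT x|lebesgue. gauss t (x::'a)) = of_real ((sqrt (2 * pi) / t) ^ DIM('a))"
    using integral_gauss_exp[OF t, of "0::'a"] by (simp add: gauss_def integral_complex_of_real)
  then show "(LINT x|lebesgue. gauss t (x::'a)) = (sqrt (2 * pi) / t) ^ DIM('a)"
    using of_real_eq_iff by blast
qed

section \<open>Fourier integrals and interchange of integrals\<close>

lemma sigma_finite_lebesgue: "sigma_finite_measure (lebesgue :: 'a::euclidean_space measure)"
proof
  obtain A :: "'a set set" where "countable A" "A \<subseteq> sets lborel" "\<Union>A = space lborel" "\<forall>a\<in>A. emeasure lborel a \<noteq> \<infinity>"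
    using sigma_finite_measure.sigma_finite_countable[OF sigma_finite_lborel] by blast
  then show "\<exists>A::'a set set. countable A \<and> A \<subseteq> sets lebesgue \<and> \<Union>A = space lebesgue \<and> (\<forall>a\<in>A. emeasure lebesgue a \<noteq> \<infinity>)"
    by (intro exI[of _ A]) (auto simp: subset_eq)
qed

interpretation lebesgue: sigma_finite_measure "lebesgue :: 'a::euclidean_space measure"
  by (rule sigma_finite_lebesgue)

interpretation lebesgue_pair: pair_sigma_finite "lebesgue :: 'a::euclidean_space measure" "lebesgue :: 'a measure"
  by standard

text \<open>The identity is measurable from the Lebesgue to the Borel sets. So a Borel kernel stays measurable
  on the product of two completed measures, and Fubini can be applied to Lebesgue measurable
  functions without passing to Borel representatives.\<close>

lemma measurable_lebesgue_pair:
  fixes K :: "'a::euclidean_space \<Rightarrow> 'a \<Rightarrow> 'c::topological_space"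
  assumes K: "(\<lambda>(x, y). K x y) \<in> borel_measurable (borel \<Otimes>\<^sub>M borel)"
  shows "(\<lambda>(x, y). K x y) \<in> borel_measurable (lebesgue \<Otimes>\<^sub>M lebesgue)"
proof -
  have id: "(\<lambda>x::'a. x) \<in> lebesgue \<rightarrow>\<^sub>M borel"
    by (simp add: measurable_completion)
  have "(\<lambda>p::'a \<times> 'a. (fst p, snd p)) \<in> lebesgue \<Otimes>\<^sub>M lebesgue \<rightarrow>\<^sub>M borel \<Otimes>\<^sub>M borel"
    by (intro measurable_Pair measurable_compose[OF measurable_fst id] measurable_compose[OF measurable_snd id])
  from measurable_compose[OF this K] show ?thesis
    by (simp add: split_beta')
qed

text \<open>The exchanges of complex integrals below all have this shape: two integrable functions joined by a
  bounded kernel, an exponential or a Gaussian.\<close>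

lemma
  fixes f g :: "'a::euclidean_space \<Rightarrow> complex" and K :: "'a \<Rightarrow> 'a \<Rightarrow> complex"
  assumes f: "integrable lebesgue f" and g: "integrable lebesgue g"
    and K: "(\<lambda>(x, y). K x y) \<in> borel_measurable (borel \<Otimes>\<^sub>M borel)"
    and B: "\<And>x y. cmod (K x y) \<le> B"
  shows integral_kernel_swap:
      "(LINT x|lebesgue. f x * (LINT y|lebesgue. g y * K x y)) = (LINT y|lebesgue. g y * (LINT x|lebesgue. f x * K x y))"
    and integrable_kernel: "integrable lebesgue (\<lambda>x. f x * (LINT y|lebesgue. g y * K x y))"
proof -
  have [measurable]: "f \<in> borel_measurable lebesgue" "g \<in> borel_measurable lebesgue"
    using f g by auto
  note [measurable] = measurable_lebesgue_pair[OF K]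
  have fg: "integrable (lebesgue \<Otimes>\<^sub>M lebesgue) (\<lambda>p. f (fst p) * g (snd p))"
  proof (rule lebesgue_pair.Fubini_integrable)
    show "integrable lebesgue (\<lambda>x. LINT y|lebesgue. norm (f (fst (x, y)) * g (snd (x, y))))"
      using f by (simp add: norm_mult)
    show "AE x in lebesgue. integrable lebesgue (\<lambda>y. f (fst (x, y)) * g (snd (x, y)))"
      using g by simp
  qed measurable
  have int: "integrable (lebesgue \<Otimes>\<^sub>M lebesgue) (\<lambda>(x, y). f x * (g y * K x y))"
  proof (rule Bochner_Integration.integrable_bound)
    show "integrable (lebesgue \<Otimes>\<^sub>M lebesgue) (\<lambda>p. of_real B * (f (fst p) * g (snd p)))"
      by (intro integrable_mult_right fg)
    have "cmod (f x) * (cmod (g y) * cmod (K x y)) \<le> \<bar>B\<bar> * (cmod (f x) * cmod (g y))" for x y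
    proof -
      have "cmod (f x) * cmod (g y) * cmod (K x y) \<le> cmod (f x) * cmod (g y) * \<bar>B\<bar>"
        by (intro mult_left_mono order_trans[OF B]) auto
      then show ?thesis by (simp add: mult_ac)
    qed
    then show "AE p in lebesgue \<Otimes>\<^sub>M lebesgue. norm (case p of (x, y) \<Rightarrow> f x * (g y * K x y))
        \<le> norm (of_real B * (f (fst p) * g (snd p)))"
      by (auto simp: norm_mult)
  qed measurable
  show "integrable lebesgue (\<lambda>x. f x * (LINT y|lebesgue. g y * K x y))"
    using lebesgue_pair.integrable_fst[OF int] by simp
  show "(LINT x|lebesgue. f x * (LINT y|lebesgue. g y * K x y)) = (LINT y|lebesgue. g y * (LINT x|lebesgue. f x * K x y))"
  proof -
    have "(LINT x|lebesgue. f x * (g y * K x y)) = g y * (LINT x|lebesgue. f x * K x y)" for y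
      by (simp only: mult.left_commute[of "f _" "g _"] integral_mult_right_zero)
    then show ?thesis
      using lebesgue_pair.Fubini_integral[OF int] by simp
  qed
qed

lemma integrable_mult_exp:
  fixes g :: "'a::euclidean_space \<Rightarrow> complex"
  assumes "integrable lebesgue g"
  shows "integrable lebesgue (\<lambda>\<xi>. g \<xi> * exp (\<i> * of_real (x \<bullet> \<xi>)))"
proof (rule Bochner_Integration.integrable_bound[OF assms])
  have [measurable]: "(\<lambda>\<xi>. exp (\<i> * of_real (x \<bullet> \<xi>))) \<in> borel_measurable (lebesgue :: 'a measure)"
    by (intro measurable_completion) measurable
  show "(\<lambda>\<xi>. g \<xi> * exp (\<i> * of_real (x \<bullet> \<xi>))) \<in> borel_measurable lebesgue"
    using assms by measurable
qed (auto simp: norm_mult)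

lemma norm_osc_int_le: "cmod (osc_int g x) \<le> (LINT \<xi>|lebesgue. cmod (g \<xi>))"
proof -
  have "cmod (osc_int g x) \<le> (LINT \<xi>|lebesgue. cmod (g \<xi> * exp (\<i> * of_real (x \<bullet> \<xi>))))"
    unfolding osc_int_def by (rule integral_norm_bound)
  then show ?thesis
    by (simp add: norm_mult)
qed

lemma continuous_on_osc_int:
  fixes g :: "'a::euclidean_space \<Rightarrow> complex"
  assumes "integrable lebesgue g"
  shows "continuous_on UNIV (osc_int g)"
  unfolding continuous_on_sequentially
proof safe
  fix u :: "nat \<Rightarrow> 'a" and a assume u: "u \<longlonglongrightarrow> a"
  show "(osc_int g \<circ> u) \<longlonglongrightarrow> osc_int g a"
    unfolding comp_def osc_int_def
  proof (rule integral_dominated_convergence)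
    show "integrable lebesgue (\<lambda>\<xi>. cmod (g \<xi>))"
      using assms by simp
    show "AE \<xi> in lebesgue. (\<lambda>n. g \<xi> * exp (\<i> * of_real (u n \<bullet> \<xi>))) \<longlonglongrightarrow> g \<xi> * exp (\<i> * of_real (a \<bullet> \<xi>))"
      by (intro AE_I2 tendsto_intros u)
    show "AE \<xi> in lebesgue. norm (g \<xi> * exp (\<i> * of_real (u n \<bullet> \<xi>))) \<le> cmod (g \<xi>)" for n
      by (auto simp: norm_mult)
  qed (use integrable_mult_exp[OF assms] in auto)
qed

lemma borel_measurable_osc_int:
  fixes g :: "'a::euclidean_space \<Rightarrow> complex"
  assumes "integrable lebesgue g"
  shows "osc_int g \<in> borel_measurable borel"
  by (intro borel_measurable_continuous_onI continuous_on_osc_int assms)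

lemma
  fixes f :: "'a::euclidean_space \<Rightarrow> 'b::{banach, second_countable_topology}"
  assumes m[measurable]: "f \<in> borel_measurable borel"
  shows integrable_lebesgue_shift: "integrable lebesgue f \<Longrightarrow> integrable lebesgue (\<lambda>x. f (x - a))"
    and integral_lebesgue_shift: "(LINT x|lebesgue. f (x - a)) = (LINT x|lebesgue. f x)"
proof -
  have ml: "f \<in> borel_measurable lborel" "(\<lambda>x. f (x - a)) \<in> borel_measurable lborel"
    by measurable
  have shift: "(\<lambda>x. x - a) = (+) (- a)"
    by (auto simp: fun_eq_iff)
  have eq: "lborel = distr lborel borel (\<lambda>x. x - a)"
    using lborel_distr_plus[of "- a"] unfolding shift by simp
  have T: "(\<lambda>x::'a. x - a) \<in> lborel \<rightarrow>\<^sub>M borel"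
    by measurable
  show "integrable lebesgue (\<lambda>x. f (x - a))" if "integrable lebesgue f"
  proof -
    have "integrable lborel f"
      using that integrable_completion[OF ml(1)] by simp
    then have "integrable lborel (\<lambda>x. f (x - a))"
      by (subst (asm) eq, subst (asm) integrable_distr_eq[OF T m])
    then show ?thesis
      by (simp add: integrable_completion[OF ml(2)])
  qed
  have "(LINT x|lebesgue. f (x - a)) = (LINT x|lborel. f (x - a))"
    by (rule integral_completion[OF ml(2)])
  also have "\<dots> = (LINT x|distr lborel borel (\<lambda>x. x - a). f x)"
    by (rule integral_distr[OF T m, symmetric])
  also have "\<dots> = (LINT x|lebesgue. f x)"
    unfolding eq[symmetric] by (rule integral_completion[OF ml(1), symmetric])
  finally show "(LINT x|lebesgue. f (x - a)) = (LINT x|lebesgue. f x)" .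
qed

lemma
  fixes \<eta> :: "'a::euclidean_space"
  assumes t: "t > 0"
  shows integrable_gauss_shift: "integrable lebesgue (\<lambda>x. gauss t (x - \<eta>))"
    and integral_gauss_shift: "(LINT x|lebesgue. gauss t (x - \<eta>)) = (sqrt (2 * pi) / t) ^ DIM('a)"
proof -
  show "integrable lebesgue (\<lambda>x. gauss t (x - \<eta>))"
    by (rule integrable_lebesgue_shift[OF borel_measurable_gauss integrable_gauss[OF t]])
  show "(LINT x|lebesgue. gauss t (x - \<eta>)) = (sqrt (2 * pi) / t) ^ DIM('a)"
    by (subst integral_lebesgue_shift[OF borel_measurable_gauss]) (rule integral_gauss[OF t])
qed

text \<open>The Fourier integral need not be integrable, so it cannot be inverted directly. Inserting a Gaussian
  factor makes the double integral absolutely convergent, and the inner integral is the transform of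
  a Gaussian: inversion returns \<open>g\<close> smeared by a Gaussian of width \<open>t\<close>.\<close>

lemma osc_int_gauss_summability:
  fixes g :: "'a::euclidean_space \<Rightarrow> complex"
  assumes g: "integrable lebesgue g" and t: "t > 0"
  shows "(LINT x|lebesgue. of_real (gauss t x) * exp (- (\<i> * of_real (x \<bullet> \<eta>))) * osc_int g x) =
     of_real ((sqrt (2 * pi) / t) ^ DIM('a)) * (LINT \<xi>|lebesgue. g \<xi> * of_real (gauss (1 / t) (\<xi> - \<eta>)))"
proof -
  let ?f = "\<lambda>x. of_real (gauss t x) * exp (- (\<i> * of_real (x \<bullet> \<eta>)))"
  have f: "integrable lebesgue ?f"
    using integrable_gauss_exp[OF t, of "- \<eta>"] by simp
  have "(LINT x|lebesgue. ?f x * osc_int g x) = (LINT \<xi>|lebesgue. g \<xi> * (LINT x|lebesgue. ?f x * exp (\<i> * of_real (x \<bullet> \<xi>))))"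
    unfolding osc_int_def by (rule integral_kernel_swap[OF f g, where B=1]) auto
  also have "(\<lambda>\<xi>. LINT x|lebesgue. ?f x * exp (\<i> * of_real (x \<bullet> \<xi>))) =
      (\<lambda>\<xi>. LINT x|lebesgue. of_real (gauss t x) * exp (\<i> * of_real (x \<bullet> (\<xi> - \<eta>))))"
    by (simp add: mult.assoc exp_add[symmetric] inner_diff_right algebra_simps)
  also have "\<dots> = (\<lambda>\<xi>. of_real ((sqrt (2 * pi) / t) ^ DIM('a) * gauss (1 / t) (\<xi> - \<eta>)))"
    using integral_gauss_exp[OF t] by auto
  finally show ?thesis
    by (simp only: of_real_mult mult.left_commute[of "g _"] integral_mult_right_zero)
qed

section \<open>Injectivity of the Fourier integral\<close>

text \<open>The conjugate sign of \<open>k\<close> is an almost everywhere limit of continuous functions. Testing against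
  these gives \<open>\<integral> |k| = 0\<close> in the limit.\<close>

lemma AE_eq_0_if_continuous_orthogonal:
  fixes k :: "'a::euclidean_space \<Rightarrow> complex"
  assumes k: "integrable lebesgue k"
    and orth: "\<And>\<phi>. continuous_on UNIV \<phi> \<Longrightarrow> (\<And>x. cmod (\<phi> x) \<le> 1) \<Longrightarrow> (LINT x|lebesgue. k x * \<phi> x) = 0"
  shows "AE x in lebesgue. k x = 0"
proof -
  have km[measurable]: "k \<in> borel_measurable lebesgue"
    using k by simp
  define s where "s x = cnj (sgn (k x))" for x
  have cnj_m[measurable]: "cnj \<in> borel_measurable borel"
    by (intro borel_measurable_continuous_onI continuous_intros)
  have sm[measurable]: "s \<in> borel_measurable lebesgue"
    unfolding s_def by measurable
  have "s measurable_on UNIV"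
    using lebesgue_measurable_imp_measurable_on[OF sm] by auto
  then obtain N g where N: "negligible N" and g: "\<And>n. continuous_on UNIV (g n)"
    and lim: "\<And>x. x \<notin> N \<Longrightarrow> (\<lambda>n. g n x) \<longlonglongrightarrow> s x"
    unfolding measurable_on_def by auto
  \<comment> \<open>Truncating the approximants to the unit disc keeps the limit, which lies in the disc.\<close>
  define h where "h n x = g n x / of_real (max 1 (cmod (g n x)))" for n x
  have h_cont: "continuous_on UNIV (h n)" for n
    unfolding h_def by (intro continuous_intros g) (auto simp: complex_eq_iff)
  have h_le: "cmod (h n x) \<le> 1" for n x
    unfolding h_def by (auto simp: norm_divide divide_le_eq max_def)
  have s_le: "cmod (s x) \<le> 1" for x
    unfolding s_def by (simp add: norm_sgn)
  have h_lim: "(\<lambda>n. h n x) \<longlonglongrightarrow> s x" if "x \<notin> N" for x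
  proof -
    have "(\<lambda>n. h n x) \<longlonglongrightarrow> s x / of_real (max 1 (cmod (s x)))"
      unfolding h_def by (intro tendsto_intros lim that) (auto simp: complex_eq_iff)
    then show ?thesis
      using s_le[of x] by (simp add: max_def split: if_splits)
  qed
  have [measurable]: "h n \<in> borel_measurable lebesgue" for n
    by (intro measurable_completion) (simp add: borel_measurable_continuous_onI h_cont)
  have "(\<lambda>n. LINT x|lebesgue. k x * h n x) \<longlonglongrightarrow> (LINT x|lebesgue. k x * s x)"
  proof (rule integral_dominated_convergence)
    show "integrable lebesgue (\<lambda>x. cmod (k x))"
      using k by simp
    have "AE x in lebesgue. x \<notin> N"
      using N by (simp add: negligible_iff_null_sets AE_not_in)
    then show "AE x in lebesgue. (\<lambda>n. k x * h n x) \<longlonglongrightarrow> k x * s x"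
      by eventually_elim (intro tendsto_intros h_lim)
    show "AE x in lebesgue. norm (k x * h n x) \<le> cmod (k x)" for n
      using h_le by (auto simp: norm_mult mult_left_le)
  qed (auto simp: s_def[abs_def])
  then have "(LINT x|lebesgue. k x * s x) = 0"
    using orth[OF h_cont h_le] by (simp add: LIMSEQ_const_iff)
  moreover have "k x * s x = of_real (cmod (k x))" for x
  proof -
    have "k x * s x = (k x * cnj (k x)) / of_real (cmod (k x))"
      by (simp add: s_def sgn_eq)
    also have "\<dots> = of_real (cmod (k x))"
      by (simp only: complex_norm_square[symmetric] of_real_divide[symmetric] power2_eq_square) simp
    finally show ?thesis .
  qed
  ultimately have "(LINT x|lebesgue. cmod (k x)) = 0"
    by (simp add: integral_complex_of_real)
  then show ?thesis
    using integral_nonneg_eq_0_iff_AE[of lebesgue "\<lambda>x. cmod (k x)"] k by simp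
qed

text \<open>The substitution \<open>\<eta> = \<xi> + u / s\<close> moves the dependence on \<open>s\<close> from the Gaussian weight to the argument of
  \<open>\<psi>\<close>, where continuity of \<open>\<psi>\<close> gives the limit \<open>s \<rightarrow> \<infinity>\<close>.\<close>

lemma gauss_average:
  fixes \<psi> :: "'a::euclidean_space \<Rightarrow> complex"
  assumes \<psi>: "\<psi> \<in> borel_measurable borel" and s: "s > 0"
  shows "of_real (s ^ DIM('a)) * (LINT \<eta>|lebesgue. \<psi> \<eta> * of_real (gauss s (\<xi> - \<eta>))) =
    (LINT u|lebesgue. \<psi> (\<xi> + (1 / s) *\<^sub>R u) * of_real (gauss 1 u))"
proof -
  note [measurable] = \<psi>
  let ?T = "\<lambda>u. \<xi> + (1 / s) *\<^sub>R u"
  let ?h = "\<lambda>\<eta>. \<psi> \<eta> * of_real (gauss s (\<xi> - \<eta>))"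
  have g: "gauss s (\<xi> - ?T u) = gauss 1 u" for u
    using s by (simp add: gauss_def power2_eq_square)
  have lb: "lborel = density (distr lborel borel ?T) (\<lambda>_. ennreal ((1 / s) ^ DIM('a)))"
    using lborel_affine[of "1 / s" \<xi>] s by simp
  have m: "?h \<in> borel_measurable lborel" "(\<lambda>u. ?h (?T u)) \<in> borel_measurable lborel"
    by measurable
  have "(LINT \<eta>|lebesgue. ?h \<eta>) = (LINT \<eta>|lborel. ?h \<eta>)"
    by (rule integral_completion[OF m(1)])
  also have "\<dots> = (LINT \<eta>|distr lborel borel ?T. ((1 / s) ^ DIM('a)) *\<^sub>R ?h \<eta>)"
    by (subst lb, subst integral_density) (use s in auto)
  also have "\<dots> = (LINT u|lborel. ((1 / s) ^ DIM('a)) *\<^sub>R ?h (?T u))"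
    by (subst integral_distr) auto
  also have "\<dots> = ((1 / s) ^ DIM('a)) *\<^sub>R (LINT u|lebesgue. ?h (?T u))"
    unfolding integral_completion[OF m(2)] by simp
  finally show ?thesis
    unfolding g using s by (simp add: scaleR_conv_of_real power_divide)
qed

text \<open>All Gaussian averages of \<open>k\<close> vanish by \<open>osc_int_gauss_summability\<close>. Moving the average over to a
  continuous test function, where it converges as the width shrinks, shows that \<open>k\<close> is orthogonal to
  the test function.\<close>

lemma osc_int_eq_0_imp_AE_eq_0:
  fixes k :: "'a::euclidean_space \<Rightarrow> complex"
  assumes k: "integrable lebesgue k" and zero: "\<And>x. osc_int k x = 0"
  shows "AE \<xi> in lebesgue. k \<xi> = 0"
proof -
  have [measurable]: "k \<in> borel_measurable lebesgue" using k by simp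
  have gm[measurable]: "(\<lambda>x. gauss s (x::'a)) \<in> borel_measurable lebesgue" for s
    by (intro measurable_completion) measurable
  have k1: "integrable lebesgue (\<lambda>\<xi>. k \<xi> * of_real (gauss 1 \<xi>))"
    by (rule Bochner_Integration.integrable_bound[OF k]) (auto simp: norm_mult mult_left_le)
  have conv0: "(LINT \<xi>|lebesgue. k \<xi> * of_real (gauss s (\<xi> - \<eta>))) = 0" if "s > 0" for s \<eta>
    using osc_int_gauss_summability[OF k, of "1 / s" \<eta>] that zero by simp
  have "AE \<xi> in lebesgue. k \<xi> * of_real (gauss 1 \<xi>) = 0"
  proof (rule AE_eq_0_if_continuous_orthogonal[OF k1])
    fix \<phi> :: "'a \<Rightarrow> complex"
    assume \<phi>: "continuous_on UNIV \<phi>" and \<phi>_le: "\<And>x. cmod (\<phi> x) \<le> 1"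
    \<comment> \<open>The test function must be integrable for the exchange of integrals; the factor \<open>gauss 1\<close> ensures this and is divided out at the end.\<close>
    define \<psi> where "\<psi> x = \<phi> x * of_real (gauss 1 x)" for x
    have \<psi>_cont: "continuous_on UNIV \<psi>"
      unfolding \<psi>_def by (intro continuous_intros \<phi>)
    then have \<psi>m[measurable]: "\<psi> \<in> borel_measurable borel"
      by (rule borel_measurable_continuous_onI)
    have \<psi>m'[measurable]: "\<psi> \<in> borel_measurable lebesgue"
      by (intro measurable_completion) measurable
    have \<psi>_le: "cmod (\<psi> x) \<le> gauss 1 x" for x
      unfolding \<psi>_def using \<phi>_le[of x] by (simp add: norm_mult mult_left_le_one_le)
    have \<psi>_le1: "cmod (\<psi> x) \<le> 1" for x
      using \<psi>_le[of x] gauss_le_1[of 1 x] by linarith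
    have \<psi>_int: "integrable lebesgue \<psi>"
      by (rule Bochner_Integration.integrable_bound[OF integrable_gauss[of 1]]) (use \<psi>_le in auto)
    define A where "A n \<xi> = (LINT u|lebesgue. \<psi> (\<xi> + (1 / real (Suc n)) *\<^sub>R u) * of_real (gauss 1 u))" for n \<xi>
    have A_eq: "A n \<xi> = of_real (real (Suc n) ^ DIM('a)) * (LINT \<eta>|lebesgue. \<psi> \<eta> * of_real (gauss (real (Suc n)) (\<xi> - \<eta>)))" for n \<xi>
      unfolding A_def by (rule gauss_average[OF \<psi>m, symmetric]) simp
    have A0: "(LINT \<xi>|lebesgue. k \<xi> * A n \<xi>) = 0" for n
    proof -
      have "(LINT \<xi>|lebesgue. k \<xi> * (LINT \<eta>|lebesgue. \<psi> \<eta> * of_real (gauss (real (Suc n)) (\<xi> - \<eta>)))) =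
        (LINT \<eta>|lebesgue. \<psi> \<eta> * (LINT \<xi>|lebesgue. k \<xi> * of_real (gauss (real (Suc n)) (\<xi> - \<eta>))))"
        by (rule integral_kernel_swap[OF k \<psi>_int, where B=1]) auto
      then show ?thesis
        unfolding A_eq by (simp only: mult.left_commute[of "k _"] integral_mult_right_zero) (simp add: conv0)
    qed
    have [measurable]: "A n \<in> borel_measurable lebesgue" for n
    proof -
      have "(\<lambda>(x, u). \<psi> (x + (1 / real (Suc n)) *\<^sub>R u) * of_real (gauss 1 u)) \<in> borel_measurable (lebesgue \<Otimes>\<^sub>M lebesgue)"
        by (rule measurable_lebesgue_pair) measurable
      from lebesgue.borel_measurable_lebesgue_integral[OF this] show ?thesis
        unfolding A_def by simp
    qed
    have A_le: "cmod (A n \<xi>) \<le> sqrt (2 * pi) ^ DIM('a)" for n \<xi>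
    proof -
      have "cmod (A n \<xi>) \<le> (LINT u|lebesgue. gauss 1 (u::'a))"
        unfolding A_def using \<psi>_le1
        by (intro order_trans[OF integral_norm_bound] Bochner_Integration.integral_mono_AE' integrable_gauss)
           (auto simp: norm_mult mult_left_le_one_le)
      then show ?thesis
        by (simp add: integral_gauss)
    qed
    have A_lim: "(\<lambda>n. A n \<xi>) \<longlonglongrightarrow> \<psi> \<xi> * of_real (sqrt (2 * pi) ^ DIM('a))" for \<xi>
    proof -
      have "(\<lambda>n. A n \<xi>) \<longlonglongrightarrow> (LINT u|lebesgue. \<psi> \<xi> * of_real (gauss 1 (u::'a)))"
        unfolding A_def
      proof (rule integral_dominated_convergence)
        show "integrable lebesgue (\<lambda>u::'a. gauss 1 u)"
          by (rule integrable_gauss) simp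
        show "AE u in lebesgue. norm (\<psi> (\<xi> + (1 / real (Suc n)) *\<^sub>R u) * of_real (gauss 1 u)) \<le> gauss 1 u" for n
          using \<psi>_le1 by (auto simp: norm_mult mult_left_le_one_le)
        have "(\<lambda>n. \<xi> + (1 / real (Suc n)) *\<^sub>R u) \<longlonglongrightarrow> \<xi> + 0 *\<^sub>R u" for u
          by (intro tendsto_intros LIMSEQ_Suc[OF lim_1_over_n])
        then have "(\<lambda>n. \<psi> (\<xi> + (1 / real (Suc n)) *\<^sub>R u)) \<longlonglongrightarrow> \<psi> \<xi>" for u
          using \<psi>_cont by (auto simp: continuous_on_eq_continuous_at intro: isCont_tendsto_compose)
        then show "AE u in lebesgue. (\<lambda>n. \<psi> (\<xi> + (1 / real (Suc n)) *\<^sub>R u) * of_real (gauss 1 u)) \<longlonglongrightarrow> \<psi> \<xi> * of_real (gauss 1 u)"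
          by (intro AE_I2 tendsto_intros)
      qed (intro measurable_completion; measurable)+
      then show ?thesis
        by (simp add: integral_complex_of_real integral_gauss)
    qed
    have "(\<lambda>n. LINT \<xi>|lebesgue. k \<xi> * A n \<xi>) \<longlonglongrightarrow> (LINT \<xi>|lebesgue. k \<xi> * (\<psi> \<xi> * of_real (sqrt (2 * pi) ^ DIM('a))))"
    proof (rule integral_dominated_convergence)
      show "integrable lebesgue (\<lambda>\<xi>. cmod (k \<xi>) * sqrt (2 * pi) ^ DIM('a))"
        using k by simp
      show "AE \<xi> in lebesgue. (\<lambda>n. k \<xi> * A n \<xi>) \<longlonglongrightarrow> k \<xi> * (\<psi> \<xi> * of_real (sqrt (2 * pi) ^ DIM('a)))"
        by (intro AE_I2 tendsto_intros A_lim)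
      show "AE \<xi> in lebesgue. norm (k \<xi> * A n \<xi>) \<le> cmod (k \<xi>) * sqrt (2 * pi) ^ DIM('a)" for n
        using A_le by (auto simp: norm_mult intro!: mult_left_mono)
    qed measurable
    then have "(LINT \<xi>|lebesgue. (k \<xi> * \<psi> \<xi>) * of_real (sqrt (2 * pi) ^ DIM('a))) = 0"
      unfolding A0 mult.assoc by (simp add: LIMSEQ_const_iff)
    then have "(LINT \<xi>|lebesgue. k \<xi> * \<psi> \<xi>) = 0"
      by simp
    then show "(LINT \<xi>|lebesgue. k \<xi> * of_real (gauss 1 \<xi>) * \<phi> \<xi>) = 0"
      unfolding \<psi>_def by (simp add: mult_ac)
  qed
  then show ?thesis
    by eventually_elim (use gauss_pos in \<open>simp add: less_imp_neq[symmetric]\<close>)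
qed

section \<open>Bessel's inequality\<close>

lemma nn_integral_le_of_AE_tendsto:
  fixes u :: "nat \<Rightarrow> 'a \<Rightarrow> ennreal"
  assumes u: "\<And>k. u k \<in> borel_measurable M" and lim: "AE x in M. (\<lambda>k. u k x) \<longlonglongrightarrow> v x"
    and le: "eventually (\<lambda>k. (\<integral>\<^sup>+x. u k x \<partial>M) \<le> C) sequentially"
  shows "(\<integral>\<^sup>+x. v x \<partial>M) \<le> C"
proof -
  have "(\<integral>\<^sup>+x. v x \<partial>M) = (\<integral>\<^sup>+x. liminf (\<lambda>k. u k x) \<partial>M)"
  proof (rule nn_integral_cong_AE)
    show "AE x in M. v x = liminf (\<lambda>k. u k x)"
      using lim by eventually_elim (simp add: lim_imp_Liminf)
  qed
  also have "\<dots> \<le> liminf (\<lambda>k. \<integral>\<^sup>+x. u k x \<partial>M)"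
    by (rule nn_integral_liminf[OF u])
  also have "\<dots> \<le> liminf (\<lambda>k. C)"
    by (rule Liminf_mono[OF le])
  finally show ?thesis
    by (simp add: Liminf_const)
qed

text \<open>A Schur test. By \<open>2 |g(\<eta>)| |g(\<xi>)| \<le> |g(\<eta>)|\<^sup>2 + |g(\<xi>)|\<^sup>2\<close> and the symmetry of the kernel, the form is at
  most the squared norm of \<open>g\<close> times the integral of the Gaussian.\<close>

lemma gauss_quadratic_form_le:
  fixes g :: "'a::euclidean_space \<Rightarrow> complex"
  assumes g: "integrable lebesgue g" and g2: "integrable lebesgue (\<lambda>x. (cmod (g x))\<^sup>2)" and s: "s > 0"
  shows "cmod (LINT \<eta>|lebesgue. cnj (g \<eta>) * (LINT \<xi>|lebesgue. g \<xi> * of_real (gauss s (\<xi> - \<eta>))))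
    \<le> (sqrt (2 * pi) / s) ^ DIM('a) * (LINT x|lebesgue. (cmod (g x))\<^sup>2)"
proof -
  have [measurable]: "g \<in> borel_measurable lebesgue" using g by simp
  define c where "c = (sqrt (2 * pi) / s) ^ DIM('a)"
  define I where "I = (LINT x|lebesgue. (cmod (g x))\<^sup>2)"
  have c: "c \<ge> 0" and I: "I \<ge> 0"
    unfolding c_def I_def using s by auto
  have Gm: "(\<lambda>(\<eta>::'a, \<xi>::'a). gauss s (\<xi> - \<eta>)) \<in> borel_measurable (lebesgue \<Otimes>\<^sub>M lebesgue)"
    by (rule measurable_lebesgue_pair) measurable
  have Gm1[measurable]: "(\<lambda>\<xi>. gauss s (\<xi> - \<eta>)) \<in> borel_measurable lebesgue" for \<eta> :: 'a
    by (intro measurable_completion) measurable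
  have Gint: "(\<integral>\<^sup>+\<xi>. ennreal (gauss s (\<xi> - \<eta>)) \<partial>lebesgue) = ennreal c" for \<eta> :: 'a
    using nn_integral_eq_integral[OF integrable_gauss_shift[OF s, of \<eta>]]
    by (simp add: integral_gauss_shift[OF s] c_def)
  have g2': "(\<integral>\<^sup>+\<xi>. ennreal ((cmod (g \<xi>))\<^sup>2) \<partial>lebesgue) = ennreal I"
    unfolding I_def by (rule nn_integral_eq_integral[OF g2]) simp
  have 1: "(\<integral>\<^sup>+\<eta>. \<integral>\<^sup>+\<xi>. ennreal ((cmod (g \<eta>))\<^sup>2 * gauss s (\<xi> - \<eta>)) \<partial>lebesgue \<partial>lebesgue) = ennreal (c * I)"
  proof -
    have "(\<integral>\<^sup>+\<xi>. ennreal ((cmod (g \<eta>))\<^sup>2 * gauss s (\<xi> - \<eta>)) \<partial>lebesgue) = ennreal ((cmod (g \<eta>))\<^sup>2) * ennreal c" for \<eta>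
      by (simp add: ennreal_mult nn_integral_cmult Gint)
    then show ?thesis
      using c I by (simp add: nn_integral_multc nn_integral_cmult g2' ennreal_mult mult.commute)
  qed
  have 2: "(\<integral>\<^sup>+\<eta>. \<integral>\<^sup>+\<xi>. ennreal ((cmod (g \<xi>))\<^sup>2 * gauss s (\<xi> - \<eta>)) \<partial>lebesgue \<partial>lebesgue) = ennreal (c * I)"
  proof -
    have "(\<integral>\<^sup>+\<eta>. \<integral>\<^sup>+\<xi>. ennreal ((cmod (g \<xi>))\<^sup>2 * gauss s (\<xi> - \<eta>)) \<partial>lebesgue \<partial>lebesgue) =
       (\<integral>\<^sup>+\<xi>. \<integral>\<^sup>+\<eta>. ennreal ((cmod (g \<xi>))\<^sup>2 * gauss s (\<xi> - \<eta>)) \<partial>lebesgue \<partial>lebesgue)"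
      by (rule lebesgue_pair.Fubini'[symmetric]) (use Gm in measurable)
    then show ?thesis
      using 1 by (simp add: gauss_minus_commute)
  qed
  have "ennreal (cmod (LINT \<eta>|lebesgue. cnj (g \<eta>) * (LINT \<xi>|lebesgue. g \<xi> * of_real (gauss s (\<xi> - \<eta>)))))
     \<le> (\<integral>\<^sup>+\<eta>. ennreal (cmod (cnj (g \<eta>) * (LINT \<xi>|lebesgue. g \<xi> * of_real (gauss s (\<xi> - \<eta>))))) \<partial>lebesgue)"
  proof (rule integral_norm_bound_ennreal)
    have "integrable lebesgue (\<lambda>x. cnj (g x))" using g by simp
    then show "integrable lebesgue (\<lambda>\<eta>. cnj (g \<eta>) * (LINT \<xi>|lebesgue. g \<xi> * of_real (gauss s (\<xi> - \<eta>))))"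
      by (rule integrable_kernel[OF _ g, where B=1]) auto
  qed
  also have "\<dots> \<le> (\<integral>\<^sup>+\<eta>. \<integral>\<^sup>+\<xi>. ennreal (cmod (g \<eta>) * cmod (g \<xi>) * gauss s (\<xi> - \<eta>)) \<partial>lebesgue \<partial>lebesgue)"
  proof (rule nn_integral_mono)
    fix \<eta>
    have int: "integrable lebesgue (\<lambda>\<xi>. g \<xi> * of_real (gauss s (\<xi> - \<eta>)))"
      by (rule Bochner_Integration.integrable_bound[OF g]) (auto simp: norm_mult mult_left_le)
    have "ennreal (cmod (cnj (g \<eta>) * (LINT \<xi>|lebesgue. g \<xi> * of_real (gauss s (\<xi> - \<eta>)))))
      = ennreal (cmod (g \<eta>)) * ennreal (cmod (LINT \<xi>|lebesgue. g \<xi> * of_real (gauss s (\<xi> - \<eta>))))"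
      by (simp add: norm_mult ennreal_mult)
    also have "\<dots> \<le> ennreal (cmod (g \<eta>)) * (\<integral>\<^sup>+\<xi>. ennreal (cmod (g \<xi> * of_real (gauss s (\<xi> - \<eta>)))) \<partial>lebesgue)"
      by (intro mult_left_mono integral_norm_bound_ennreal int) simp
    also have "\<dots> = (\<integral>\<^sup>+\<xi>. ennreal (cmod (g \<eta>) * cmod (g \<xi>) * gauss s (\<xi> - \<eta>)) \<partial>lebesgue)"
      by (subst nn_integral_cmult[symmetric]) (auto simp: norm_mult ennreal_mult[symmetric] mult_ac)
    finally show "ennreal (cmod (cnj (g \<eta>) * (LINT \<xi>|lebesgue. g \<xi> * of_real (gauss s (\<xi> - \<eta>))))) \<le> \<dots>" .
  qed
  also have "\<dots> \<le> (\<integral>\<^sup>+\<eta>. \<integral>\<^sup>+\<xi>. ennreal (1 / 2) * (ennreal ((cmod (g \<eta>))\<^sup>2 * gauss s (\<xi> - \<eta>)) + ennreal ((cmod (g \<xi>))\<^sup>2 * gauss s (\<xi> - \<eta>))) \<partial>lebesgue \<partial>lebesgue)"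
  proof (intro nn_integral_mono)
    fix \<eta> \<xi>
    have "cmod (g \<eta>) * cmod (g \<xi>) \<le> ((cmod (g \<eta>))\<^sup>2 + (cmod (g \<xi>))\<^sup>2) / 2"
      using sum_squares_bound[of "cmod (g \<eta>)" "cmod (g \<xi>)"] by simp
    then have "cmod (g \<eta>) * cmod (g \<xi>) * gauss s (\<xi> - \<eta>) \<le> ((cmod (g \<eta>))\<^sup>2 + (cmod (g \<xi>))\<^sup>2) / 2 * gauss s (\<xi> - \<eta>)"
      by (rule mult_right_mono) simp
    also have "\<dots> = 1 / 2 * ((cmod (g \<eta>))\<^sup>2 * gauss s (\<xi> - \<eta>) + (cmod (g \<xi>))\<^sup>2 * gauss s (\<xi> - \<eta>))"
      by (simp add: field_simps)
    finally show "ennreal (cmod (g \<eta>) * cmod (g \<xi>) * gauss s (\<xi> - \<eta>)) \<le>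
       ennreal (1 / 2) * (ennreal ((cmod (g \<eta>))\<^sup>2 * gauss s (\<xi> - \<eta>)) + ennreal ((cmod (g \<xi>))\<^sup>2 * gauss s (\<xi> - \<eta>)))"
      by (simp only: ennreal_plus[symmetric] ennreal_mult[symmetric] gauss_nonneg zero_le_power2 mult_nonneg_nonneg add_nonneg_nonneg zero_le_divide_1_iff zero_le_numeral ennreal_leI)
  qed
  also have "\<dots> = ennreal (1 / 2) * (ennreal (c * I) + ennreal (c * I))"
  proof -
    have m1: "(\<lambda>(\<eta>, \<xi>). ennreal ((cmod (g \<eta>))\<^sup>2 * gauss s (\<xi> - \<eta>))) \<in> borel_measurable (lebesgue \<Otimes>\<^sub>M lebesgue)"
      and m2: "(\<lambda>(\<eta>, \<xi>). ennreal ((cmod (g \<xi>))\<^sup>2 * gauss s (\<xi> - \<eta>))) \<in> borel_measurable (lebesgue \<Otimes>\<^sub>M lebesgue)"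
      using Gm by measurable
    have [measurable]: "(\<lambda>\<eta>. \<integral>\<^sup>+\<xi>. ennreal ((cmod (g \<eta>))\<^sup>2 * gauss s (\<xi> - \<eta>)) \<partial>lebesgue) \<in> borel_measurable lebesgue"
      "(\<lambda>\<eta>. \<integral>\<^sup>+\<xi>. ennreal ((cmod (g \<xi>))\<^sup>2 * gauss s (\<xi> - \<eta>)) \<partial>lebesgue) \<in> borel_measurable lebesgue"
      using lebesgue.borel_measurable_nn_integral[OF m1] lebesgue.borel_measurable_nn_integral[OF m2] by auto
    show ?thesis
      by (subst nn_integral_cmult, measurable, subst nn_integral_add, measurable,
          subst nn_integral_cmult, measurable, subst nn_integral_add, measurable, subst 1, subst 2) simp
  qed
  also have "\<dots> = ennreal (c * I)"
  proof -
    have "ennreal (c * I) + ennreal (c * I) = ennreal (2 * (c * I))"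
      using c I by (subst ennreal_plus[symmetric]) auto
    then show ?thesis
      using c I by (simp only: ennreal_mult[symmetric] mult_nonneg_nonneg zero_le_numeral zero_le_divide_1_iff) simp
  qed
  finally show ?thesis
    using c I unfolding c_def[symmetric] I_def[symmetric] by (subst (asm) ennreal_le_iff) auto
qed

text \<open>Writing \<open>|osc_int g|\<^sup>2\<close> as \<open>osc_int g\<close> times its conjugate and expanding the conjugate turns the left
  side into the quadratic form above. The factor \<open>(\<surd>(2\<pi>) / t)\<^sup>d\<close> from the transform of the Gaussian and the
  factor \<open>(\<surd>(2\<pi>) t)\<^sup>d\<close> from the Schur test multiply to \<open>(2\<pi>)\<^sup>d\<close> for every \<open>t\<close>, so that the bound survives
  the limit \<open>t \<rightarrow> 0\<close>.\<close>

lemma integral_gauss_norm_osc_int_le: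
  fixes g :: "'a::euclidean_space \<Rightarrow> complex"
  assumes g: "integrable lebesgue g" and g2: "integrable lebesgue (\<lambda>x. (cmod (g x))\<^sup>2)" and t: "t > 0"
  shows "integrable lebesgue (\<lambda>x. gauss t x * (cmod (osc_int g x))\<^sup>2)"
    and "(LINT x|lebesgue. gauss t x * (cmod (osc_int g x))\<^sup>2) \<le> (2 * pi) ^ DIM('a) * (LINT x|lebesgue. (cmod (g x))\<^sup>2)"
proof -
  define P where "P x = of_real (gauss t x) * osc_int g x" for x
  define B where "B = (LINT x|lebesgue. cmod (g x))"
  have om[measurable]: "osc_int g \<in> borel_measurable lebesgue"
    by (intro measurable_completion) (use borel_measurable_osc_int[OF g] in simp)
  have gm[measurable]: "(gauss t :: 'a \<Rightarrow> real) \<in> borel_measurable lebesgue"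
    by (intro measurable_completion) measurable
  have B: "cmod (osc_int g x) \<le> B" for x
    unfolding B_def by (rule norm_osc_int_le)
  have P: "integrable lebesgue P"
  proof (rule Bochner_Integration.integrable_bound)
    show "integrable lebesgue (\<lambda>x::'a. gauss t x * B)"
      using integrable_gauss[OF t, where 'a='a] by simp
    show "AE x in lebesgue. norm (P x) \<le> norm (gauss t x * B)"
      unfolding P_def using B by (auto simp: norm_mult abs_mult intro!: mult_left_mono order_trans[OF B])
    show "P \<in> borel_measurable lebesgue"
      unfolding P_def by measurable
  qed
  show int: "integrable lebesgue (\<lambda>x. gauss t x * (cmod (osc_int g x))\<^sup>2)"
  proof (rule Bochner_Integration.integrable_bound)
    show "integrable lebesgue (\<lambda>x. P x * of_real B)"
      using P by simp
    have "cmod (osc_int g x) * cmod (osc_int g x) \<le> cmod (osc_int g x) * \<bar>B\<bar>" for x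
      by (intro mult_left_mono order_trans[OF B]) auto
    then show "AE x in lebesgue. norm (gauss t x * (cmod (osc_int g x))\<^sup>2) \<le> norm (P x * of_real B)"
      unfolding P_def by (auto simp: norm_mult abs_mult power2_eq_square mult.assoc intro!: mult_left_mono)
  qed measurable
  have cnj_osc: "cnj (osc_int g x) = (LINT \<eta>|lebesgue. cnj (g \<eta>) * exp (- (\<i> * of_real (x \<bullet> \<eta>))))" for x
    unfolding osc_int_def by (subst Bochner_Integration.integral_cnj[symmetric]) (simp add: exp_cnj)
  have "complex_of_real (LINT x|lebesgue. gauss t x * (cmod (osc_int g x))\<^sup>2) = (LINT x|lebesgue. P x * cnj (osc_int g x))"
  proof -
    have "P x * cnj (osc_int g x) = of_real (gauss t x * (cmod (osc_int g x))\<^sup>2)" for x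
      unfolding P_def mult.assoc complex_norm_square[symmetric] by simp
    then show ?thesis
      by (simp only: integral_complex_of_real)
  qed
  also have "\<dots> = (LINT \<eta>|lebesgue. cnj (g \<eta>) * (LINT x|lebesgue. P x * exp (- (\<i> * of_real (x \<bullet> \<eta>)))))"
    unfolding cnj_osc by (rule integral_kernel_swap[OF P, where B=1]) (use g in auto)
  also have "(\<lambda>\<eta>. LINT x|lebesgue. P x * exp (- (\<i> * of_real (x \<bullet> \<eta>)))) =
    (\<lambda>\<eta>. of_real ((sqrt (2 * pi) / t) ^ DIM('a)) * (LINT \<xi>|lebesgue. g \<xi> * of_real (gauss (1 / t) (\<xi> - \<eta>))))"
    unfolding osc_int_gauss_summability[OF g t, symmetric] P_def by (simp add: mult_ac)
  also have "(LINT \<eta>|lebesgue. cnj (g \<eta>) * (of_real ((sqrt (2 * pi) / t) ^ DIM('a)) * (LINT \<xi>|lebesgue. g \<xi> * of_real (gauss (1 / t) (\<xi> - \<eta>))))) =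
     of_real ((sqrt (2 * pi) / t) ^ DIM('a)) * (LINT \<eta>|lebesgue. cnj (g \<eta>) * (LINT \<xi>|lebesgue. g \<xi> * of_real (gauss (1 / t) (\<xi> - \<eta>))))"
    by (simp only: mult.left_commute[of "cnj _"] integral_mult_right_zero)
  finally have eq: "complex_of_real (LINT x|lebesgue. gauss t x * (cmod (osc_int g x))\<^sup>2) = \<dots>" .
  have "(LINT x|lebesgue. gauss t x * (cmod (osc_int g x))\<^sup>2) = cmod (complex_of_real (LINT x|lebesgue. gauss t x * (cmod (osc_int g x))\<^sup>2))"
    by (simp only: norm_of_real) (simp add: abs_of_nonneg integral_nonneg_AE)
  also have "\<dots> = (sqrt (2 * pi) / t) ^ DIM('a) * cmod (LINT \<eta>|lebesgue. cnj (g \<eta>) * (LINT \<xi>|lebesgue. g \<xi> * of_real (gauss (1 / t) (\<xi> - \<eta>))))"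
    unfolding eq norm_mult norm_of_real using t by simp
  also have "\<dots> \<le> (sqrt (2 * pi) / t) ^ DIM('a) * ((sqrt (2 * pi) / (1 / t)) ^ DIM('a) * (LINT x|lebesgue. (cmod (g x))\<^sup>2))"
    by (intro mult_left_mono gauss_quadratic_form_le g g2) (use t in auto)
  also have "\<dots> = (2 * pi) ^ DIM('a) * (LINT x|lebesgue. (cmod (g x))\<^sup>2)"
    unfolding mult.assoc[symmetric] power_mult_distrib[symmetric] using t by simp
  finally show "(LINT x|lebesgue. gauss t x * (cmod (osc_int g x))\<^sup>2) \<le> (2 * pi) ^ DIM('a) * (LINT x|lebesgue. (cmod (g x))\<^sup>2)" .
qed

lemma osc_int_bessel:
  fixes g :: "'a::euclidean_space \<Rightarrow> complex"
  assumes g: "integrable lebesgue g" and g2: "integrable lebesgue (\<lambda>x. (cmod (g x))\<^sup>2)"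
  shows "(\<integral>\<^sup>+x. ennreal ((cmod (osc_int g x))\<^sup>2) \<partial>lebesgue) \<le> ennreal ((2 * pi) ^ DIM('a) * (LINT x|lebesgue. (cmod (g x))\<^sup>2))"
proof (rule nn_integral_le_of_AE_tendsto)
  let ?u = "\<lambda>n x. ennreal (gauss (1 / real (Suc n)) x * (cmod (osc_int g x))\<^sup>2)"
  have [measurable]: "osc_int g \<in> borel_measurable borel"
    by (rule borel_measurable_osc_int[OF g])
  show "?u n \<in> borel_measurable lebesgue" for n
    by (intro measurable_completion) measurable
  have "(\<lambda>n. gauss (1 / real (Suc n)) x) \<longlonglongrightarrow> exp (- (0\<^sup>2 * (x \<bullet> x) / 2))" for x :: 'a
    unfolding gauss_def by (intro tendsto_intros LIMSEQ_Suc[OF lim_1_over_n]) auto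
  then have "(\<lambda>n. gauss (1 / real (Suc n)) x * (cmod (osc_int g x))\<^sup>2) \<longlonglongrightarrow> 1 * (cmod (osc_int g x))\<^sup>2" for x
    by (intro tendsto_mult tendsto_const) simp
  then show "AE x in lebesgue. (\<lambda>n. ?u n x) \<longlonglongrightarrow> ennreal ((cmod (osc_int g x))\<^sup>2)"
    by (intro AE_I2 tendsto_ennrealI) simp
  show "eventually (\<lambda>n. (\<integral>\<^sup>+x. ?u n x \<partial>lebesgue) \<le> ennreal ((2 * pi) ^ DIM('a) * (LINT x|lebesgue. (cmod (g x))\<^sup>2))) sequentially"
  proof (intro always_eventually allI)
    fix n
    have t: "1 / real (Suc n) > 0" by simp
    have "(\<integral>\<^sup>+x. ?u n x \<partial>lebesgue) = ennreal (LINT x|lebesgue. gauss (1 / real (Suc n)) x * (cmod (osc_int g x))\<^sup>2)"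
      by (rule nn_integral_eq_integral[OF integral_gauss_norm_osc_int_le(1)[OF g g2 t]]) simp
    also have "\<dots> \<le> ennreal ((2 * pi) ^ DIM('a) * (LINT x|lebesgue. (cmod (g x))\<^sup>2))"
      by (intro ennreal_leI integral_gauss_norm_osc_int_le(2)[OF g g2 t])
    finally show "(\<integral>\<^sup>+x. ?u n x \<partial>lebesgue) \<le> \<dots>" .
  qed
qed

section \<open>Completeness and the existence of the square integrable transform\<close>

lemma nn_integral_norm_diff_square_le:
  fixes a b c :: "'a \<Rightarrow> complex"
  assumes [measurable]: "a \<in> borel_measurable M" "b \<in> borel_measurable M" "c \<in> borel_measurable M"
  shows "(\<integral>\<^sup>+x. ennreal ((cmod (a x - b x))\<^sup>2) \<partial>M) \<le>
    2 * (\<integral>\<^sup>+x. ennreal ((cmod (a x - c x))\<^sup>2) \<partial>M) + 2 * (\<integral>\<^sup>+x. ennreal ((cmod (b x - c x))\<^sup>2) \<partial>M)"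
proof -
  have le: "(cmod (p - q))\<^sup>2 \<le> 2 * (cmod (p - r))\<^sup>2 + 2 * (cmod (q - r))\<^sup>2" for p q r :: complex
  proof -
    have "(cmod (p - q))\<^sup>2 \<le> (cmod (p - r) + cmod (q - r))\<^sup>2"
      using norm_triangle_ineq4[of "p - r" "q - r"] by (intro power_mono) auto
    also have "\<dots> \<le> 2 * (cmod (p - r))\<^sup>2 + 2 * (cmod (q - r))\<^sup>2"
      using sum_squares_bound[of "cmod (p - r)" "cmod (q - r)"] by (simp add: power2_sum)
    finally show ?thesis .
  qed
  have "(\<integral>\<^sup>+x. ennreal ((cmod (a x - b x))\<^sup>2) \<partial>M) \<le>
     (\<integral>\<^sup>+x. 2 * ennreal ((cmod (a x - c x))\<^sup>2) + 2 * ennreal ((cmod (b x - c x))\<^sup>2) \<partial>M)"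
  proof (rule nn_integral_mono)
    fix x
    have "ennreal ((cmod (a x - b x))\<^sup>2) \<le> ennreal (2 * (cmod (a x - c x))\<^sup>2 + 2 * (cmod (b x - c x))\<^sup>2)"
      by (rule ennreal_leI[OF le])
    then show "ennreal ((cmod (a x - b x))\<^sup>2) \<le> 2 * ennreal ((cmod (a x - c x))\<^sup>2) + 2 * ennreal ((cmod (b x - c x))\<^sup>2)"
      by (simp add: ennreal_mult)
  qed
  also have "\<dots> = 2 * (\<integral>\<^sup>+x. ennreal ((cmod (a x - c x))\<^sup>2) \<partial>M) + 2 * (\<integral>\<^sup>+x. ennreal ((cmod (b x - c x))\<^sup>2) \<partial>M)"
    by (simp add: nn_integral_add nn_integral_cmult)
  finally show ?thesis .
qed

lemma convergent_if_geometric_steps: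
  fixes a :: "nat \<Rightarrow> complex"
  assumes "\<And>k. (cmod (a (Suc k) - a k))\<^sup>2 \<le> C * (1 / 4) ^ k"
  shows "convergent a"
proof -
  have C: "C \<ge> 0"
    using order_trans[OF zero_le_power2 assms[of 0]] by simp
  have "summable (\<lambda>k. a (Suc k) - a k)"
  proof (rule summable_comparison_test)
    show "summable (\<lambda>k. sqrt C * (1 / 2) ^ k)"
      by (intro summable_mult summable_geometric) simp
    have "cmod (a (Suc k) - a k) \<le> sqrt C * (1 / 2) ^ k" for k
    proof (rule power2_le_imp_le)
      have "(1 / 4 :: real) ^ k = ((1 / 2) ^ k)\<^sup>2"
        by (simp add: power2_eq_square power_mult_distrib[symmetric])
      then show "(cmod (a (Suc k) - a k))\<^sup>2 \<le> (sqrt C * (1 / 2) ^ k)\<^sup>2"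
        using assms[of k] C by (simp add: power_mult_distrib)
    qed (use C in simp)
    then show "\<exists>N. \<forall>n\<ge>N. norm (a (Suc n) - a n) \<le> sqrt C * (1 / 2) ^ n"
      by blast
  qed
  then have "(\<lambda>n. a 0 + (\<Sum>k<n. a (Suc k) - a k)) \<longlonglongrightarrow> a 0 + (\<Sum>k. a (Suc k) - a k)"
    by (intro tendsto_intros summable_LIMSEQ)
  then show ?thesis
    by (auto simp: sum_lessThan_telescope convergent_def)
qed

text \<open>The Riesz--Fischer theorem. Choose a subsequence whose steps have squared norms at most \<open>8\<^sup>-\<^sup>k\<close>. Then
  \<open>\<Sum>k. 4\<^sup>k |step k|\<^sup>2\<close> has finite integral, so almost everywhere the steps are bounded by a geometric
  sequence and the subsequence converges. Fatou's lemma shows that the pointwise limit is the limit in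
  mean square.\<close>

lemma L2_complete:
  fixes u :: "nat \<Rightarrow> 'a \<Rightarrow> complex"
  assumes u[measurable]: "\<And>n. u n \<in> borel_measurable M"
    and Cauchy: "\<And>e. e > 0 \<Longrightarrow> \<exists>N. \<forall>m\<ge>N. \<forall>n\<ge>N. (\<integral>\<^sup>+x. ennreal ((cmod (u m x - u n x))\<^sup>2) \<partial>M) \<le> ennreal e"
  obtains g where "g \<in> borel_measurable M" "(\<lambda>n. \<integral>\<^sup>+x. ennreal ((cmod (u n x - g x))\<^sup>2) \<partial>M) \<longlonglongrightarrow> 0"
proof -
  have "\<forall>k. \<exists>N. \<forall>m\<ge>N. \<forall>n\<ge>N. (\<integral>\<^sup>+x. ennreal ((cmod (u m x - u n x))\<^sup>2) \<partial>M) \<le> ennreal ((1 / 8) ^ k)"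
    by (intro allI Cauchy) simp
  then obtain N where N: "\<And>k m n. m \<ge> N k \<Longrightarrow> n \<ge> N k \<Longrightarrow> (\<integral>\<^sup>+x. ennreal ((cmod (u m x - u n x))\<^sup>2) \<partial>M) \<le> ennreal ((1 / 8) ^ k)"
    by metis
  \<comment> \<open>Both \<open>r k\<close> and \<open>r (Suc k)\<close> are at least \<open>N k\<close>; the summand \<open>k\<close> makes \<open>r\<close> unbounded.\<close>
  define r where "r k = k + (\<Sum>j\<le>k. N j)" for k
  have r_ge: "r k \<ge> N k" "r (Suc k) \<ge> N k" "r k \<ge> k" for k
    using member_le_sum[of k "{..k}" N] by (auto simp: r_def)
  have step: "(\<integral>\<^sup>+x. ennreal ((cmod (u (r (Suc k)) x - u (r k) x))\<^sup>2) \<partial>M) \<le> ennreal ((1 / 8) ^ k)" for k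
    by (rule N[of k]) (use r_ge in auto)
  define S where "S x = (\<Sum>k. ennreal (4 ^ k * (cmod (u (r (Suc k)) x - u (r k) x))\<^sup>2))" for x
  have S_m[measurable]: "S \<in> borel_measurable M"
    unfolding S_def by measurable
  have "(\<integral>\<^sup>+x. S x \<partial>M) = (\<Sum>k. \<integral>\<^sup>+x. ennreal (4 ^ k * (cmod (u (r (Suc k)) x - u (r k) x))\<^sup>2) \<partial>M)"
    unfolding S_def by (rule nn_integral_suminf) measurable
  also have "\<dots> \<le> (\<Sum>k. ennreal ((1 / 2) ^ k))"
  proof (rule suminf_le)
    fix k
    have "(\<integral>\<^sup>+x. ennreal (4 ^ k * (cmod (u (r (Suc k)) x - u (r k) x))\<^sup>2) \<partial>M) =
       ennreal (4 ^ k) * (\<integral>\<^sup>+x. ennreal ((cmod (u (r (Suc k)) x - u (r k) x))\<^sup>2) \<partial>M)"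
      by (subst nn_integral_cmult[symmetric]) (auto simp: ennreal_mult)
    also have "\<dots> \<le> ennreal (4 ^ k) * ennreal ((1 / 8) ^ k)"
      by (intro mult_left_mono step) simp
    also have "\<dots> = ennreal ((1 / 2) ^ k)"
      by (simp add: ennreal_mult[symmetric] power_mult_distrib[symmetric])
    finally show "(\<integral>\<^sup>+x. ennreal (4 ^ k * (cmod (u (r (Suc k)) x - u (r k) x))\<^sup>2) \<partial>M) \<le> ennreal ((1 / 2) ^ k)" .
  qed (auto intro: summableI)
  also have "\<dots> < \<infinity>"
    unfolding infinity_ennreal_def less_top[symmetric]
    by (rule ennreal_suminf_neq_top) (auto intro!: summable_geometric)
  finally have "AE x in M. S x \<noteq> \<infinity>"
    by (intro nn_integral_PInf_AE) auto
  then have conv: "AE x in M. convergent (\<lambda>k. u (r k) x)"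
  proof eventually_elim
    fix x assume "S x \<noteq> \<infinity>"
    then obtain C where C: "S x = ennreal C" "C \<ge> 0"
      by (cases "S x") auto
    have "(cmod (u (r (Suc k)) x - u (r k) x))\<^sup>2 \<le> C * (1 / 4) ^ k" for k
    proof -
      define t where "t k = ennreal (4 ^ k * (cmod (u (r (Suc k)) x - u (r k) x))\<^sup>2)" for k
      have "sum t {k} \<le> suminf t"
        by (rule sum_le_suminf[OF summableI]) auto
      then have "ennreal (4 ^ k * (cmod (u (r (Suc k)) x - u (r k) x))\<^sup>2) \<le> S x"
        by (simp add: S_def t_def[abs_def, symmetric]) (simp add: t_def)
      then have "4 ^ k * (cmod (u (r (Suc k)) x - u (r k) x))\<^sup>2 \<le> C"
        unfolding C(1) ennreal_le_iff[OF C(2)] .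
      then show ?thesis
        by (simp add: power_divide field_simps)
    qed
    then show "convergent (\<lambda>k. u (r k) x)"
      by (rule convergent_if_geometric_steps)
  qed
  define g where "g x = lim (\<lambda>k. u (r k) x)" for x
  have g[measurable]: "g \<in> borel_measurable M"
    unfolding g_def by measurable
  have g_lim: "AE x in M. (\<lambda>k. u (r k) x) \<longlonglongrightarrow> g x"
    using conv by eventually_elim (simp add: g_def convergent_LIMSEQ_iff)
  have "(\<lambda>n. \<integral>\<^sup>+x. ennreal ((cmod (u n x - g x))\<^sup>2) \<partial>M) \<longlonglongrightarrow> 0"
  proof (rule order_tendstoI)
    fix b :: ennreal assume "0 < b"
    then obtain c where c: "0 < c" "c < b"
      using dense by blast
    then obtain e where e: "e > 0" "ennreal e < b"
      by (cases c) (auto simp: less_top[symmetric])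
    then obtain K where K: "\<And>m n. m \<ge> K \<Longrightarrow> n \<ge> K \<Longrightarrow> (\<integral>\<^sup>+x. ennreal ((cmod (u m x - u n x))\<^sup>2) \<partial>M) \<le> ennreal e"
      using Cauchy by meson
    have "(\<integral>\<^sup>+x. ennreal ((cmod (u n x - g x))\<^sup>2) \<partial>M) \<le> ennreal e" if "n \<ge> K" for n
    proof (rule nn_integral_le_of_AE_tendsto)
      show "AE x in M. (\<lambda>k. ennreal ((cmod (u n x - u (r k) x))\<^sup>2)) \<longlonglongrightarrow> ennreal ((cmod (u n x - g x))\<^sup>2)"
        using g_lim by eventually_elim (intro tendsto_ennrealI tendsto_intros)
      show "eventually (\<lambda>k. (\<integral>\<^sup>+x. ennreal ((cmod (u n x - u (r k) x))\<^sup>2) \<partial>M) \<le> ennreal e) sequentially"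
        using eventually_ge_at_top[of K]
        by eventually_elim (use that r_ge(3) order_trans in \<open>blast intro: K\<close>)
    qed measurable
    then show "eventually (\<lambda>n. (\<integral>\<^sup>+x. ennreal ((cmod (u n x - g x))\<^sup>2) \<partial>M) < b) sequentially"
      unfolding eventually_sequentially using e(2) le_less_trans by blast
  qed simp
  with g show ?thesis by (rule that)
qed

lemma mem_L2_space_iff:
  "u \<in> L2_space \<longleftrightarrow> u \<in> borel_measurable lebesgue \<and> integrable lebesgue (\<lambda>x. (cmod (u x))\<^sup>2)"
  by (simp add: L2_space_def wL2_def)

lemma mem_L2_space_iff_nn_integral:
  "u \<in> L2_space \<longleftrightarrow> u \<in> borel_measurable lebesgue \<and> (\<integral>\<^sup>+x. ennreal ((cmod (u x))\<^sup>2) \<partial>lebesgue) < \<infinity>"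
  by (auto simp: mem_L2_space_iff integrable_iff_bounded)

text \<open>The two conjugations reverse the sign of the phase and leave the argument \<open>\<xi>\<close> in place, so Bessel's
  inequality for \<open>osc_int\<close> applies to the right side as it stands.\<close>

lemma fourier_L1_eq_osc_int:
  fixes u :: "real^'d \<Rightarrow> complex"
  shows "fourier_L1 u \<xi> = of_real (1 / (2 * pi) ^ CARD('d)) * cnj (osc_int (\<lambda>x. cnj (u x)) \<xi>)"
proof -
  have "cnj (osc_int (\<lambda>x. cnj (u x)) \<xi>) = (LINT x|lebesgue. u x * exp (- (\<i> * of_real (x \<bullet> \<xi>))))"
    unfolding osc_int_def
    by (subst Bochner_Integration.integral_cnj[symmetric]) (simp add: exp_cnj inner_commute)
  then show ?thesis
    by (simp add: fourier_L1_def)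
qed

lemma borel_measurable_fourier_L1:
  fixes u :: "real^'d \<Rightarrow> complex"
  assumes "integrable lebesgue u"
  shows "fourier_L1 u \<in> borel_measurable lebesgue"
proof -
  have [measurable]: "osc_int (\<lambda>x. cnj (u x)) \<in> borel_measurable borel"
    by (rule borel_measurable_osc_int) (use assms in simp)
  have [measurable]: "cnj \<in> borel_measurable borel"
    by (intro borel_measurable_continuous_onI continuous_intros)
  have eq: "fourier_L1 u = (\<lambda>\<xi>. of_real (1 / (2 * pi) ^ CARD('d)) * cnj (osc_int (\<lambda>x. cnj (u x)) \<xi>))"
    by (rule ext) (rule fourier_L1_eq_osc_int)
  show ?thesis
    unfolding eq by (intro measurable_completion) measurable
qed

lemma fourier_L1_diff:
  fixes u v :: "real^'d \<Rightarrow> complex"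
  assumes "integrable lebesgue u" "integrable lebesgue v"
  shows "fourier_L1 (\<lambda>x. u x - v x) \<xi> = fourier_L1 u \<xi> - fourier_L1 v \<xi>"
proof -
  have i: "integrable lebesgue (\<lambda>x. w x * exp (- (\<i> * of_real (x \<bullet> \<xi>))))"
    if "integrable lebesgue w" for w :: "real^'d \<Rightarrow> complex"
    using integrable_mult_exp[OF that, of "- \<xi>"] by (simp add: inner_commute)
  show ?thesis
    unfolding fourier_L1_def left_diff_distrib
    by (simp add: Bochner_Integration.integral_diff i assms right_diff_distrib)
qed

text \<open>In this normalisation the sharp constant is \<open>(2\<pi>)\<^sup>-\<^sup>d\<close>; the constant \<open>1\<close> is all that continuity of the
  transform requires.\<close>

lemma fourier_L1_bessel:
  fixes u :: "real^'d \<Rightarrow> complex"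
  assumes u: "integrable lebesgue u" "u \<in> L2_space"
  shows "(\<integral>\<^sup>+\<xi>. ennreal ((cmod (fourier_L1 u \<xi>))\<^sup>2) \<partial>lebesgue) \<le> (\<integral>\<^sup>+x. ennreal ((cmod (u x))\<^sup>2) \<partial>lebesgue)"
proof -
  let ?c = "(2 * pi) ^ CARD('d)"
  have c: "?c \<ge> 1"
    using pi_gt3 by (intro one_le_power) simp
  have u2: "integrable lebesgue (\<lambda>x. (cmod (u x))\<^sup>2)"
    using u by (simp add: mem_L2_space_iff)
  have [measurable]: "osc_int (\<lambda>x. cnj (u x)) \<in> borel_measurable lebesgue"
    by (intro measurable_completion) (use borel_measurable_osc_int[of "\<lambda>x. cnj (u x)"] u in simp)
  have "(\<integral>\<^sup>+\<xi>. ennreal ((cmod (fourier_L1 u \<xi>))\<^sup>2) \<partial>lebesgue) =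
     (\<integral>\<^sup>+\<xi>. ennreal ((1 / ?c)\<^sup>2) * ennreal ((cmod (osc_int (\<lambda>x. cnj (u x)) \<xi>))\<^sup>2) \<partial>lebesgue)"
    unfolding fourier_L1_eq_osc_int norm_mult power_mult_distrib norm_of_real power2_abs
    by (simp add: ennreal_mult[symmetric])
  also have "\<dots> = ennreal ((1 / ?c)\<^sup>2) * (\<integral>\<^sup>+\<xi>. ennreal ((cmod (osc_int (\<lambda>x. cnj (u x)) \<xi>))\<^sup>2) \<partial>lebesgue)"
    by (rule nn_integral_cmult) measurable
  also have "\<dots> \<le> ennreal ((1 / ?c)\<^sup>2) * ennreal (?c * (LINT x|lebesgue. (cmod (u x))\<^sup>2))"
    using osc_int_bessel[of "\<lambda>x. cnj (u x)"] u u2 by (intro mult_left_mono) auto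
  also have "\<dots> = ennreal (1 / ?c * (LINT x|lebesgue. (cmod (u x))\<^sup>2))"
    by (subst ennreal_mult[symmetric]) (use c in \<open>auto simp: power2_eq_square\<close>)
  also have "\<dots> \<le> ennreal (LINT x|lebesgue. (cmod (u x))\<^sup>2)"
  proof (rule ennreal_leI)
    have "1 / ?c * (LINT x|lebesgue. (cmod (u x))\<^sup>2) \<le> 1 * (LINT x|lebesgue. (cmod (u x))\<^sup>2)"
      by (rule mult_right_mono) (use c in auto)
    then show "1 / ?c * (LINT x|lebesgue. (cmod (u x))\<^sup>2) \<le> (LINT x|lebesgue. (cmod (u x))\<^sup>2)"
      by simp
  qed
  also have "\<dots> = (\<integral>\<^sup>+x. ennreal ((cmod (u x))\<^sup>2) \<partial>lebesgue)"
    by (rule nn_integral_eq_integral[OF u2, symmetric]) simp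
  finally show ?thesis .
qed

lemma L2_space_approx_integrable:
  fixes u :: "real^'d \<Rightarrow> complex"
  assumes u: "u \<in> L2_space"
  obtains v where "\<And>k. integrable lebesgue (v k)" "\<And>k. v k \<in> L2_space" "tendsto_L2 v u"
proof
  have um[measurable]: "u \<in> borel_measurable lebesgue" and u2: "integrable lebesgue (\<lambda>x. (cmod (u x))\<^sup>2)"
    using u by (auto simp: mem_L2_space_iff)
  define v where "v k x = u x * indicator (cball 0 (real k)) x" for k x
  have [measurable]: "cball (0::real^'d) r \<in> sets lebesgue" for r
    by simp
  have vm[measurable]: "v k \<in> borel_measurable lebesgue" for k
    unfolding v_def by measurable
  show v2: "v k \<in> L2_space" for k
    unfolding mem_L2_space_iff
  proof
    show "integrable lebesgue (\<lambda>x. (cmod (v k x))\<^sup>2)"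
      by (rule Bochner_Integration.integrable_bound[OF u2], measurable) (auto simp: v_def indicator_def)
  qed (rule vm)
  show "integrable lebesgue (v k)" for k
  proof (rule Bochner_Integration.integrable_bound)
    have "integrable lebesgue (\<lambda>x. indicat_real (cball (0::real^'d) (real k)) x)"
      by (rule integrable_real_indicator) (use emeasure_lborel_cball_finite[of "0::real^'d"] in auto)
    then show "integrable lebesgue (\<lambda>x. (cmod (u x))\<^sup>2 + indicat_real (cball (0::real^'d) (real k)) x)"
      by (intro Bochner_Integration.integrable_add u2)
    have "r \<le> r\<^sup>2 + 1" for r :: real
      using zero_le_power2[of "r - 1 / 2"] by (simp add: power2_eq_square algebra_simps)
    then show "AE x in lebesgue. norm (v k x) \<le> norm ((cmod (u x))\<^sup>2 + indicat_real (cball 0 (real k)) x)"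
      by (auto simp: v_def indicator_def)
  qed measurable
  have "(\<lambda>k. \<integral>\<^sup>+x. ennreal ((cmod (v k x - u x))\<^sup>2) \<partial>lebesgue) \<longlonglongrightarrow> (\<integral>\<^sup>+(x::real^'d). 0 \<partial>lebesgue)"
  proof (rule nn_integral_dominated_convergence)
    show "AE x in lebesgue. ennreal ((cmod (v k x - u x))\<^sup>2) \<le> ennreal ((cmod (u x))\<^sup>2)" for k
      by (auto simp: v_def indicator_def)
    show "(\<integral>\<^sup>+x. ennreal ((cmod (u x))\<^sup>2) \<partial>lebesgue) < \<infinity>"
      using u by (simp add: mem_L2_space_iff_nn_integral)
    show "AE x in lebesgue. (\<lambda>k. ennreal ((cmod (v k x - u x))\<^sup>2)) \<longlonglongrightarrow> 0"
    proof (intro AE_I2 tendsto_eventually)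
      fix x :: "real^'d"
      obtain K where "norm x \<le> real K"
        using real_arch_simple by blast
      then show "eventually (\<lambda>k. ennreal ((cmod (v k x - u x))\<^sup>2) = 0) sequentially"
        unfolding eventually_sequentially
        by (intro exI[of _ K]) (auto simp: v_def indicator_def)
    qed
  qed measurable
  then show "tendsto_L2 v u"
    by (simp add: tendsto_L2_def)
qed

lemma ex_has_fourier_L2:
  fixes u :: "real^'d \<Rightarrow> complex"
  assumes u: "u \<in> L2_space"
  shows "\<exists>g. has_fourier_L2 u g"
proof -
  obtain v where v1: "\<And>k. integrable lebesgue (v k)" and v2: "\<And>k. v k \<in> L2_space" and vu: "tendsto_L2 v u"
    using L2_space_approx_integrable[OF u] by blast
  have m[measurable]: "u \<in> borel_measurable lebesgue" "v k \<in> borel_measurable lebesgue"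
      "fourier_L1 (v k) \<in> borel_measurable lebesgue" for k
    using u v2 borel_measurable_fourier_L1[OF v1] by (auto simp: mem_L2_space_iff)
  have diff: "(\<integral>\<^sup>+x. ennreal ((cmod (v m x - v n x))\<^sup>2) \<partial>lebesgue) \<le>
      2 * (\<integral>\<^sup>+x. ennreal ((cmod (v m x - u x))\<^sup>2) \<partial>lebesgue) + 2 * (\<integral>\<^sup>+x. ennreal ((cmod (v n x - u x))\<^sup>2) \<partial>lebesgue)" for m n
    by (rule nn_integral_norm_diff_square_le) measurable
  have Cauchy_v: "\<exists>N. \<forall>m\<ge>N. \<forall>n\<ge>N. (\<integral>\<^sup>+x. ennreal ((cmod (v m x - v n x))\<^sup>2) \<partial>lebesgue) \<le> ennreal e" if "e > 0" for e
  proof -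
    have "eventually (\<lambda>k. (\<integral>\<^sup>+x. ennreal ((cmod (v k x - u x))\<^sup>2) \<partial>lebesgue) < ennreal (e / 4)) sequentially"
      by (rule order_tendstoD(2)[OF vu[unfolded tendsto_L2_def]]) (use that in simp)
    then obtain N where N: "\<And>k. k \<ge> N \<Longrightarrow> (\<integral>\<^sup>+x. ennreal ((cmod (v k x - u x))\<^sup>2) \<partial>lebesgue) \<le> ennreal (e / 4)"
      unfolding eventually_sequentially by (meson less_imp_le)
    have "(\<integral>\<^sup>+x. ennreal ((cmod (v m x - v n x))\<^sup>2) \<partial>lebesgue) \<le> ennreal e" if mn: "m \<ge> N" "n \<ge> N" for m n
    proof -
      have "(\<integral>\<^sup>+x. ennreal ((cmod (v m x - v n x))\<^sup>2) \<partial>lebesgue) \<le> 2 * ennreal (e / 4) + 2 * ennreal (e / 4)"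
        by (rule order_trans[OF diff]) (intro add_mono mult_left_mono N mn; simp)
      also have "2 * ennreal (e / 4) = ennreal (2 * (e / 4))"
        using \<open>e > 0\<close> by (subst ennreal_mult) auto
      also have "ennreal (2 * (e / 4)) + ennreal (2 * (e / 4)) = ennreal e"
        using \<open>e > 0\<close> by (subst ennreal_plus[symmetric]) auto
      finally show ?thesis .
    qed
    then show ?thesis by blast
  qed
  have diff_hat: "(\<integral>\<^sup>+x. ennreal ((cmod (fourier_L1 (v m) x - fourier_L1 (v n) x))\<^sup>2) \<partial>lebesgue)
      \<le> (\<integral>\<^sup>+x. ennreal ((cmod (v m x - v n x))\<^sup>2) \<partial>lebesgue)" for m n
  proof -
    have "(\<integral>\<^sup>+x. ennreal ((cmod (v m x - v n x))\<^sup>2) \<partial>lebesgue) < \<infinity>"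
    proof -
      have "(\<integral>\<^sup>+x. ennreal ((cmod (v m x - v n x))\<^sup>2) \<partial>lebesgue) \<le>
        2 * (\<integral>\<^sup>+x. ennreal ((cmod (v m x - 0))\<^sup>2) \<partial>lebesgue) + 2 * (\<integral>\<^sup>+x. ennreal ((cmod (v n x - 0))\<^sup>2) \<partial>lebesgue)"
        by (rule nn_integral_norm_diff_square_le) measurable
      also have "\<dots> < \<infinity>"
        using v2[of m] v2[of n] by (simp add: mem_L2_space_iff_nn_integral ennreal_mult_less_top)
      finally show ?thesis .
    qed
    then have "(\<lambda>x. v m x - v n x) \<in> L2_space"
      unfolding mem_L2_space_iff_nn_integral by (intro conjI) measurable
    from fourier_L1_bessel[OF Bochner_Integration.integrable_diff[OF v1 v1] this] show ?thesis
      by (simp only: fourier_L1_diff[OF v1 v1])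
  qed
  obtain g where g[measurable]: "g \<in> borel_measurable lebesgue"
    and lim: "(\<lambda>k. \<integral>\<^sup>+x. ennreal ((cmod (fourier_L1 (v k) x - g x))\<^sup>2) \<partial>lebesgue) \<longlonglongrightarrow> 0"
  proof (rule L2_complete[of "\<lambda>k. fourier_L1 (v k)" lebesgue])
    fix e :: real assume "e > 0"
    then obtain N where "\<forall>m\<ge>N. \<forall>n\<ge>N. (\<integral>\<^sup>+x. ennreal ((cmod (v m x - v n x))\<^sup>2) \<partial>lebesgue) \<le> ennreal e"
      using Cauchy_v by blast
    then show "\<exists>N. \<forall>m\<ge>N. \<forall>n\<ge>N. (\<integral>\<^sup>+x. ennreal ((cmod (fourier_L1 (v m) x - fourier_L1 (v n) x))\<^sup>2) \<partial>lebesgue) \<le> ennreal e"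
      by (intro exI[of _ N] allI impI order_trans[OF diff_hat]) blast
  qed measurable
  have "g \<in> L2_space"
    unfolding mem_L2_space_iff_nn_integral
  proof
    obtain k where k: "(\<integral>\<^sup>+x. ennreal ((cmod (fourier_L1 (v k) x - g x))\<^sup>2) \<partial>lebesgue) < 1"
      using order_tendstoD(2)[OF lim, of 1] by (auto simp: eventually_sequentially)
    have sym: "cmod (g x - fourier_L1 (v k) x) = cmod (fourier_L1 (v k) x - g x)" for x
      by (rule norm_minus_commute)
    have "(\<integral>\<^sup>+x. ennreal ((cmod (g x - 0))\<^sup>2) \<partial>lebesgue) \<le>
        2 * (\<integral>\<^sup>+x. ennreal ((cmod (g x - fourier_L1 (v k) x))\<^sup>2) \<partial>lebesgue) + 2 * (\<integral>\<^sup>+x. ennreal ((cmod (0 - fourier_L1 (v k) x))\<^sup>2) \<partial>lebesgue)"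
      by (rule nn_integral_norm_diff_square_le) measurable
    also have "\<dots> < \<infinity>"
    proof -
      have "(\<integral>\<^sup>+x. ennreal ((cmod (fourier_L1 (v k) x))\<^sup>2) \<partial>lebesgue) < \<infinity>"
        using fourier_L1_bessel[OF v1[of k] v2[of k]] v2[of k]
        by (simp add: mem_L2_space_iff_nn_integral le_less_trans)
      moreover have "(\<integral>\<^sup>+x. ennreal ((cmod (fourier_L1 (v k) x - g x))\<^sup>2) \<partial>lebesgue) < \<infinity>"
        using k by (rule less_trans) simp
      ultimately show ?thesis
        unfolding sym by (simp add: ennreal_mult_less_top)
    qed
    finally show "(\<integral>\<^sup>+x. ennreal ((cmod (g x))\<^sup>2) \<partial>lebesgue) < \<infinity>"
      by simp
  qed (rule g)
  then have "has_fourier_L2 u g"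
    unfolding has_fourier_L2_def tendsto_L2_def using u v1 v2 vu[unfolded tendsto_L2_def] lim by blast
  then show ?thesis by blast
qed

section \<open>Inversion by pairing with Gaussians\<close>

text \<open>A Gaussian translated by \<open>a\<close> and modulated by the frequency \<open>b\<close>. Up to a constant the Fourier
  transform maps this two-parameter family to itself, exchanging translation and modulation; the case
  \<open>a = 0\<close> serves to identify transforms, the case \<open>b = 0\<close> to identify the functions transformed.\<close>

definition mgauss :: "'a::euclidean_space \<Rightarrow> 'a \<Rightarrow> 'a \<Rightarrow> complex" where
  "mgauss a b \<xi> = exp (\<i> * of_real (b \<bullet> \<xi>)) * of_real (gauss 1 (\<xi> - a))"

lemma borel_measurable_mgauss [measurable]: "mgauss a b \<in> borel_measurable borel"
  unfolding mgauss_def by measurable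

lemma borel_measurable_lebesgue_mgauss [measurable]: "mgauss a b \<in> borel_measurable lebesgue"
  by (intro measurable_completion) measurable

lemma norm_mgauss: "cmod (mgauss a b \<xi>) = gauss 1 (\<xi> - a)"
  by (simp add: mgauss_def norm_mult)

lemma integrable_mgauss: "integrable lebesgue (mgauss a b)"
  by (rule Bochner_Integration.integrable_bound[OF integrable_gauss_shift[of 1 a]])
     (auto simp: norm_mgauss)

lemma mgauss_in_L2_space: "mgauss a b \<in> L2_space"
  unfolding mem_L2_space_iff
proof
  show "integrable lebesgue (\<lambda>x. (cmod (mgauss a b x))\<^sup>2)"
    by (rule Bochner_Integration.integrable_bound[OF integrable_gauss_shift[of 1 a]], simp, measurable)
       (auto simp: norm_mgauss power2_eq_square mult_left_le_one_le)
qed measurable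

lemma osc_int_mgauss:
  fixes a :: "'a::euclidean_space"
  shows "osc_int (mgauss a b) x = of_real (sqrt (2 * pi) ^ DIM('a)) * exp (\<i> * of_real (a \<bullet> (x + b))) * of_real (gauss 1 (x + b))"
proof -
  let ?h = "\<lambda>\<zeta>. of_real (gauss 1 \<zeta>) * exp (\<i> * of_real (\<zeta> \<bullet> (x + b)))"
  have m: "?h \<in> borel_measurable borel" by measurable
  have "mgauss a b \<xi> * exp (\<i> * of_real (x \<bullet> \<xi>)) = exp (\<i> * of_real (a \<bullet> (x + b))) * ?h (\<xi> - a)" for \<xi>
  proof -
    have "exp (\<i> * of_real (a \<bullet> (x + b))) * exp (\<i> * of_real ((\<xi> - a) \<bullet> (x + b)))
       = exp (\<i> * of_real (b \<bullet> \<xi>)) * exp (\<i> * complex_of_real (x \<bullet> \<xi>))"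
      by (simp only: exp_add[symmetric]) (simp add: algebra_simps inner_simps inner_commute)
    then show ?thesis
      unfolding mgauss_def by (simp add: mult_ac)
  qed
  then have "osc_int (mgauss a b) x = exp (\<i> * of_real (a \<bullet> (x + b))) * (LINT \<xi>|lebesgue. ?h (\<xi> - a))"
    unfolding osc_int_def by simp
  also have "(LINT \<xi>|lebesgue. ?h (\<xi> - a)) = (LINT \<xi>|lebesgue. ?h \<xi>)"
    by (rule integral_lebesgue_shift[OF m])
  also have "\<dots> = of_real (sqrt (2 * pi) ^ DIM('a) * gauss 1 (x + b))"
    using integral_gauss_exp[of 1 "x + b"] by simp
  finally show ?thesis
    by simp
qed

lemma fourier_L1_eq_osc_int_minus:
  fixes u :: "real^'d \<Rightarrow> complex"
  shows "fourier_L1 u \<xi> = of_real (1 / (2 * pi) ^ CARD('d)) * osc_int u (- \<xi>)"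
  by (simp add: fourier_L1_def osc_int_def inner_commute)

lemma fourier_L1_mgauss:
  fixes a b :: "real^'d"
  shows "fourier_L1 (mgauss a b) =
    (\<lambda>x. of_real (sqrt (2 * pi) ^ CARD('d) / (2 * pi) ^ CARD('d)) * exp (\<i> * of_real (a \<bullet> b)) * mgauss b (- a) x)"
proof
  fix x
  have "exp (\<i> * of_real (a \<bullet> (- x + b))) = exp (\<i> * of_real (a \<bullet> b)) * exp (\<i> * complex_of_real (- a \<bullet> x))"
    by (simp only: exp_add[symmetric]) (simp add: algebra_simps inner_simps)
  then show "fourier_L1 (mgauss a b) x =
    of_real (sqrt (2 * pi) ^ CARD('d) / (2 * pi) ^ CARD('d)) * exp (\<i> * of_real (a \<bullet> b)) * mgauss b (- a) x"
    unfolding fourier_L1_eq_osc_int_minus osc_int_mgauss mgauss_def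
    using gauss_minus[of 1 "x - b"] by (simp add: field_simps)
qed

lemma osc_int_cmult: "osc_int (\<lambda>x. c * g x) \<xi> = c * osc_int g \<xi>"
  by (simp add: osc_int_def mult.assoc)

lemma osc_int_fourier_L1_mgauss:
  fixes a b :: "real^'d"
  shows "osc_int (fourier_L1 (mgauss a b)) \<xi> = mgauss a b \<xi>"
proof -
  have c: "sqrt (2 * pi) ^ CARD('d) / (2 * pi) ^ CARD('d) * sqrt (2 * pi) ^ CARD('d) = 1"
  proof -
    have "sqrt (2 * pi) ^ CARD('d) * sqrt (2 * pi) ^ CARD('d) = (2 * pi) ^ CARD('d)"
      unfolding power_mult_distrib[symmetric] by (subst real_sqrt_mult_self) simp
    moreover have "(2 * pi) ^ CARD('d) \<noteq> 0"
      by simp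
    ultimately show ?thesis
      unfolding times_divide_eq_left by (metis divide_self)
  qed
  have "exp (\<i> * of_real (a \<bullet> b)) * exp (\<i> * of_real (b \<bullet> (\<xi> + - a))) = exp (\<i> * complex_of_real (b \<bullet> \<xi>))"
    by (simp only: exp_add[symmetric]) (simp add: algebra_simps inner_simps inner_commute)
  moreover have "osc_int (fourier_L1 (mgauss a b)) \<xi> =
     of_real (sqrt (2 * pi) ^ CARD('d) / (2 * pi) ^ CARD('d) * sqrt (2 * pi) ^ CARD('d)) *
      (exp (\<i> * of_real (a \<bullet> b)) * exp (\<i> * of_real (b \<bullet> (\<xi> + - a)))) * of_real (gauss 1 (\<xi> + - a))"
    unfolding fourier_L1_mgauss osc_int_cmult osc_int_mgauss by (simp add: mult_ac)
  ultimately show ?thesis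
    unfolding c mgauss_def by simp
qed

lemma integrable_mult_L2:
  assumes "u \<in> L2_space" "w \<in> L2_space"
  shows "integrable lebesgue (\<lambda>x. u x * w x)"
proof (rule Bochner_Integration.integrable_bound)
  have [measurable]: "u \<in> borel_measurable lebesgue" "w \<in> borel_measurable lebesgue"
    using assms by (auto simp: mem_L2_space_iff)
  show "integrable lebesgue (\<lambda>x. (cmod (u x))\<^sup>2 + (cmod (w x))\<^sup>2)"
    using assms by (simp add: mem_L2_space_iff)
  have "r * s \<le> r\<^sup>2 + s\<^sup>2" if "r \<ge> 0" "s \<ge> 0" for r s :: real
    using sum_squares_bound[of r s] mult_nonneg_nonneg[OF that] by linarith
  then show "AE x in lebesgue. norm (u x * w x) \<le> norm ((cmod (u x))\<^sup>2 + (cmod (w x))\<^sup>2)"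
    by (auto simp: norm_mult)
qed (use assms in \<open>auto simp: mem_L2_space_iff\<close>)

text \<open>The Cauchy--Schwarz inequality, in its extended nonnegative form.\<close>

lemma tendsto_L2_pairing:
  fixes u w :: "real^'d \<Rightarrow> complex"
  assumes v: "\<And>k. v k \<in> L2_space" and u: "u \<in> L2_space" and w: "w \<in> L2_space" and lim: "tendsto_L2 v u"
  shows "(\<lambda>k. LINT x|lebesgue. v k x * w x) \<longlonglongrightarrow> (LINT x|lebesgue. u x * w x)"
proof -
  have [measurable]: "v k \<in> borel_measurable lebesgue" "u \<in> borel_measurable lebesgue" "w \<in> borel_measurable lebesgue" for k
    using u v w by (auto simp: mem_L2_space_iff)
  define W where "W = (\<integral>\<^sup>+x. ennreal ((cmod (w x))\<^sup>2) \<partial>lebesgue)"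
  define D where "D k = (\<integral>\<^sup>+x. ennreal ((cmod (v k x - u x))\<^sup>2) \<partial>lebesgue)" for k
  have W: "W < top"
    using w by (simp add: W_def mem_L2_space_iff_nn_integral)
  have le: "ennreal ((cmod ((LINT x|lebesgue. v k x * w x) - (LINT x|lebesgue. u x * w x)))\<^sup>2) \<le> W * D k" for k
  proof -
    have int: "integrable lebesgue (\<lambda>x. v k x * w x - u x * w x)"
      by (intro Bochner_Integration.integrable_diff integrable_mult_L2 u v w)
    have "ennreal (cmod ((LINT x|lebesgue. v k x * w x) - (LINT x|lebesgue. u x * w x)))
      = ennreal (cmod (LINT x|lebesgue. v k x * w x - u x * w x))"
      by (subst Bochner_Integration.integral_diff) (auto intro: integrable_mult_L2 u v w)
    also have "\<dots> \<le> (\<integral>\<^sup>+x. ennreal (cmod (v k x * w x - u x * w x)) \<partial>lebesgue)"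
      by (rule integral_norm_bound_ennreal[OF int])
    also have "\<dots> = (\<integral>\<^sup>+x. ennreal (cmod (w x)) * ennreal (cmod (v k x - u x)) \<partial>lebesgue)"
    proof -
      have "v k x * w x - u x * w x = w x * (v k x - u x)" for x
        by (simp add: algebra_simps)
      then show ?thesis
        by (simp only: norm_mult ennreal_mult norm_ge_zero)
    qed
    finally have "(ennreal (cmod ((LINT x|lebesgue. v k x * w x) - (LINT x|lebesgue. u x * w x))))\<^sup>2
       \<le> (\<integral>\<^sup>+x. ennreal (cmod (w x)) * ennreal (cmod (v k x - u x)) \<partial>lebesgue)\<^sup>2"
      by (rule power_mono) simp
    also have "\<dots> \<le> (\<integral>\<^sup>+x. (ennreal (cmod (w x)))\<^sup>2 \<partial>lebesgue) * (\<integral>\<^sup>+x. (ennreal (cmod (v k x - u x)))\<^sup>2 \<partial>lebesgue)"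
      by (rule Cauchy_Schwarz_nn_integral) measurable
    also have "\<dots> = W * D k"
      by (simp add: W_def D_def ennreal_power)
    finally show ?thesis
      by (simp add: ennreal_power)
  qed
  have "D \<longlonglongrightarrow> 0"
    using lim unfolding tendsto_L2_def D_def .
  from ennreal_tendsto_cmult[OF W this] have "(\<lambda>k. W * D k) \<longlonglongrightarrow> 0"
    by simp
  then have "(\<lambda>k. ennreal ((cmod ((LINT x|lebesgue. v k x * w x) - (LINT x|lebesgue. u x * w x)))\<^sup>2)) \<longlonglongrightarrow> 0"
    by (rule tendsto_sandwich[OF _ _ tendsto_const, rotated 2]) (intro always_eventually allI le zero_le)+
  then have "(\<lambda>k. (cmod ((LINT x|lebesgue. v k x * w x) - (LINT x|lebesgue. u x * w x)))\<^sup>2) \<longlonglongrightarrow> 0"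
    by (rule ennreal_tendsto_0_iff[THEN iffD1, rotated]) (rule zero_le_power2)
  from tendsto_real_sqrt[OF this]
  have "(\<lambda>k. cmod ((LINT x|lebesgue. v k x * w x) - (LINT x|lebesgue. u x * w x))) \<longlonglongrightarrow> 0"
    by (simp only: real_sqrt_abs abs_norm_cancel real_sqrt_zero)
  then show ?thesis
    by (rule LIM_zero_cancel[OF tendsto_norm_zero_cancel])
qed

lemma fourier_L1_multiplication:
  fixes u \<phi> :: "real^'d \<Rightarrow> complex"
  assumes u: "integrable lebesgue u" and \<phi>: "integrable lebesgue \<phi>"
  shows "(LINT \<xi>|lebesgue. fourier_L1 u \<xi> * \<phi> \<xi>) = (LINT x|lebesgue. u x * fourier_L1 \<phi> x)"
proof -
  let ?c = "complex_of_real (1 / (2 * pi) ^ CARD('d))"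
  have "(LINT \<xi>|lebesgue. fourier_L1 u \<xi> * \<phi> \<xi>) = ?c * (LINT \<xi>|lebesgue. \<phi> \<xi> * (LINT x|lebesgue. u x * exp (- (\<i> * of_real (x \<bullet> \<xi>)))))"
    unfolding fourier_L1_def by (simp add: mult_ac)
  also have "(LINT \<xi>|lebesgue. \<phi> \<xi> * (LINT x|lebesgue. u x * exp (- (\<i> * of_real (x \<bullet> \<xi>)))))
     = (LINT x|lebesgue. u x * (LINT \<xi>|lebesgue. \<phi> \<xi> * exp (- (\<i> * of_real (x \<bullet> \<xi>)))))"
    by (rule integral_kernel_swap[OF \<phi> u, where B=1]) auto
  also have "?c * \<dots> = (LINT x|lebesgue. u x * (?c * (LINT \<xi>|lebesgue. \<phi> \<xi> * exp (- (\<i> * of_real (x \<bullet> \<xi>))))))"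
    by (simp only: mult.left_commute[of "u _"] integral_mult_right_zero)
  finally show ?thesis
    unfolding fourier_L1_def by (simp add: inner_commute)
qed

lemma fourier_L1_in_L2_space:
  fixes u :: "real^'d \<Rightarrow> complex"
  assumes "integrable lebesgue u" "u \<in> L2_space"
  shows "fourier_L1 u \<in> L2_space"
  using fourier_L1_bessel[OF assms] borel_measurable_fourier_L1[OF assms(1)] assms(2)
  unfolding mem_L2_space_iff_nn_integral by (simp add: le_less_trans)

text \<open>This determines the transform weakly and does not depend on the approximating sequence: both sides
  are continuous in mean square, and for integrable functions the formula is Fubini's theorem.\<close>

lemma has_fourier_L2_multiplication:
  fixes u G :: "real^'d \<Rightarrow> complex"
  assumes uG: "has_fourier_L2 u G" and \<phi>: "integrable lebesgue \<phi>" "\<phi> \<in> L2_space"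
  shows "(LINT \<xi>|lebesgue. G \<xi> * \<phi> \<xi>) = (LINT x|lebesgue. u x * fourier_L1 \<phi> x)"
proof -
  obtain v where v1: "\<And>k. integrable lebesgue (v k)" and v2: "\<And>k. v k \<in> L2_space"
    and vu: "tendsto_L2 v u" and vG: "tendsto_L2 (\<lambda>k. fourier_L1 (v k)) G"
    and u: "u \<in> L2_space" and G: "G \<in> L2_space"
    using uG unfolding has_fourier_L2_def by blast
  have "(\<lambda>k. LINT \<xi>|lebesgue. fourier_L1 (v k) \<xi> * \<phi> \<xi>) \<longlonglongrightarrow> (LINT \<xi>|lebesgue. G \<xi> * \<phi> \<xi>)"
    by (intro tendsto_L2_pairing fourier_L1_in_L2_space v1 v2 G \<phi> vG)
  moreover have "(\<lambda>k. LINT x|lebesgue. v k x * fourier_L1 \<phi> x) \<longlonglongrightarrow> (LINT x|lebesgue. u x * fourier_L1 \<phi> x)"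
    by (intro tendsto_L2_pairing fourier_L1_in_L2_space v1 v2 u \<phi> vu)
  ultimately show ?thesis
    unfolding fourier_L1_multiplication[OF v1 \<phi>(1)] by (rule LIMSEQ_unique)
qed

text \<open>The previous relation for \<open>u = osc_int h\<close> and \<open>G = h\<close>, obtained without knowing that \<open>h\<close> is the
  transform of \<open>osc_int h\<close>: moving the exponential to the test function needs the inversion formula only
  for Gaussians.\<close>

lemma osc_int_multiplication_mgauss:
  fixes h :: "real^'d \<Rightarrow> complex"
  assumes h: "integrable lebesgue h"
  shows "(LINT x|lebesgue. osc_int h x * fourier_L1 (mgauss a b) x) = (LINT \<xi>|lebesgue. h \<xi> * mgauss a b \<xi>)"
proof -
  have i: "integrable lebesgue (fourier_L1 (mgauss a b))"
    unfolding fourier_L1_mgauss by (intro integrable_mult_right integrable_mgauss)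
  have "(LINT x|lebesgue. osc_int h x * fourier_L1 (mgauss a b) x) =
    (LINT x|lebesgue. fourier_L1 (mgauss a b) x * (LINT \<xi>|lebesgue. h \<xi> * exp (\<i> * of_real (x \<bullet> \<xi>))))"
    unfolding osc_int_def by (simp add: mult.commute)
  also have "\<dots> = (LINT \<xi>|lebesgue. h \<xi> * (LINT x|lebesgue. fourier_L1 (mgauss a b) x * exp (\<i> * of_real (x \<bullet> \<xi>))))"
    by (rule integral_kernel_swap[OF i h, where B=1]) auto
  also have "\<dots> = (LINT \<xi>|lebesgue. h \<xi> * osc_int (fourier_L1 (mgauss a b)) \<xi>)"
    unfolding osc_int_def by (simp add: inner_commute)
  finally show ?thesis
    unfolding osc_int_fourier_L1_mgauss .
qed

text \<open>Pairing with \<open>mgauss 0 b\<close> for all \<open>b\<close> computes the Fourier integral of the function multiplied by a fixed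
  Gaussian, which is integrable; injectivity applies, and the Gaussian factor has no zeros.\<close>

lemma AE_eq_if_mgauss_eq:
  fixes u w :: "real^'d \<Rightarrow> complex"
  assumes u: "u \<in> L2_space" and w: "w \<in> L2_space"
    and eq: "\<And>b. (LINT x|lebesgue. u x * mgauss 0 b x) = (LINT x|lebesgue. w x * mgauss 0 b x)"
  shows "AE x in lebesgue. u x = w x"
proof -
  have g: "(\<lambda>x::real^'d. complex_of_real (gauss 1 x)) \<in> L2_space"
    using mgauss_in_L2_space[of 0 0] by (simp add: mgauss_def[abs_def])
  have int: "integrable lebesgue (\<lambda>x. u x * of_real (gauss 1 x) - w x * of_real (gauss 1 x))"
    by (intro Bochner_Integration.integrable_diff integrable_mult_L2 u w g)
  have "AE x in lebesgue. u x * of_real (gauss 1 x) - w x * of_real (gauss 1 x) = 0"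
  proof (rule osc_int_eq_0_imp_AE_eq_0[OF int])
    fix b :: "real^'d"
    have "osc_int (\<lambda>x. u x * of_real (gauss 1 x) - w x * of_real (gauss 1 x)) b
       = (LINT x|lebesgue. u x * mgauss 0 b x - w x * mgauss 0 b x)"
      unfolding osc_int_def mgauss_def by (intro Bochner_Integration.integral_cong refl) (simp add: algebra_simps)
    also have "\<dots> = (LINT x|lebesgue. u x * mgauss 0 b x) - (LINT x|lebesgue. w x * mgauss 0 b x)"
      by (intro Bochner_Integration.integral_diff integrable_mult_L2 u w mgauss_in_L2_space)
    finally show "osc_int (\<lambda>x. u x * of_real (gauss 1 x) - w x * of_real (gauss 1 x)) b = 0"
      using eq by simp
  qed
  then show ?thesis
  proof eventually_elim
    fix x :: "real^'d"
    have "gauss 1 x \<noteq> 0"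
      using gauss_pos[of 1 x] by linarith
    then show "u x * of_real (gauss 1 x) - w x * of_real (gauss 1 x) = 0 \<Longrightarrow> u x = w x"
      by simp
  qed
qed

lemma osc_int_in_L2_space:
  fixes g :: "real^'d \<Rightarrow> complex"
  assumes g: "integrable lebesgue g" "g \<in> L2_space"
  shows "osc_int g \<in> L2_space"
  unfolding mem_L2_space_iff_nn_integral
proof
  show "osc_int g \<in> borel_measurable lebesgue"
    by (intro measurable_completion) (use borel_measurable_osc_int[OF g(1)] in simp)
  show "(\<integral>\<^sup>+x. ennreal ((cmod (osc_int g x))\<^sup>2) \<partial>lebesgue) < \<infinity>"
    using osc_int_bessel[of g] g by (auto simp: mem_L2_space_iff intro: le_less_trans)
qed

lemma has_fourier_L2_osc_int_unique:
  fixes g G :: "real^'d \<Rightarrow> complex"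
  assumes g: "integrable lebesgue g" "g \<in> L2_space" and G: "has_fourier_L2 (osc_int g) G"
  shows "AE \<xi> in lebesgue. G \<xi> = g \<xi>"
proof (rule AE_eq_if_mgauss_eq)
  show "G \<in> L2_space"
    using G by (simp add: has_fourier_L2_def)
  show "(LINT \<xi>|lebesgue. G \<xi> * mgauss 0 b \<xi>) = (LINT \<xi>|lebesgue. g \<xi> * mgauss 0 b \<xi>)" for b
    unfolding has_fourier_L2_multiplication[OF G integrable_mgauss mgauss_in_L2_space]
    by (rule osc_int_multiplication_mgauss[OF g(1)])
qed (rule g)

lemma has_fourier_L2_inversion:
  fixes u h G :: "real^'d \<Rightarrow> complex"
  assumes uG: "has_fourier_L2 u G" and h: "integrable lebesgue h" "h \<in> L2_space" and eq: "AE \<xi> in lebesgue. G \<xi> = h \<xi>"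
  shows "AE x in lebesgue. u x = osc_int h x"
proof (rule AE_eq_if_mgauss_eq)
  show "u \<in> L2_space" and "osc_int h \<in> L2_space"
    using uG osc_int_in_L2_space[OF h] by (auto simp: has_fourier_L2_def)
  have [measurable]: "G \<in> borel_measurable lebesgue" "h \<in> borel_measurable lebesgue"
    using uG h by (auto simp: has_fourier_L2_def mem_L2_space_iff)
  fix b :: "real^'d"
  \<comment> \<open>Pairing with \<open>G\<close> calls for a translated Gaussian, whose transform is the modulated one.\<close>
  let ?K = "complex_of_real (sqrt (2 * pi) ^ CARD('d) / (2 * pi) ^ CARD('d))"
  have K: "?K \<noteq> 0" by simp
  have F: "fourier_L1 (mgauss (- b) 0) x = ?K * mgauss 0 b x" for x
    unfolding fourier_L1_mgauss by simp
  have "(LINT x|lebesgue. u x * fourier_L1 (mgauss (- b) 0) x) = (LINT \<xi>|lebesgue. G \<xi> * mgauss (- b) 0 \<xi>)"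
    by (rule has_fourier_L2_multiplication[OF uG integrable_mgauss mgauss_in_L2_space, symmetric])
  also have "\<dots> = (LINT \<xi>|lebesgue. h \<xi> * mgauss (- b) 0 \<xi>)"
    by (rule Bochner_Integration.integral_cong_AE) (use eq in \<open>auto elim: eventually_mono\<close>)
  also have "\<dots> = (LINT x|lebesgue. osc_int h x * fourier_L1 (mgauss (- b) 0) x)"
    by (rule osc_int_multiplication_mgauss[OF h(1), symmetric])
  finally have "?K * (LINT x|lebesgue. u x * mgauss 0 b x) = ?K * (LINT x|lebesgue. osc_int h x * mgauss 0 b x)"
    unfolding F by (simp only: mult.left_commute[of _ ?K] integral_mult_right_zero)
  then show "(LINT x|lebesgue. u x * mgauss 0 b x) = (LINT x|lebesgue. osc_int h x * mgauss 0 b x)"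
    by (rule mult_left_cancel[OF K, THEN iffD1])
qed

lemma has_fourier_L2_fourier_L2: "u \<in> L2_space \<Longrightarrow> has_fourier_L2 u (fourier_L2 u)"
  unfolding fourier_L2_def by (rule someI_ex[OF ex_has_fourier_L2])

text \<open>Continuity of \<open>u\<close> and of \<open>osc_int h\<close> turns the almost everywhere identity of
  \<open>has_fourier_L2_inversion\<close> into an identity at every point.\<close>

theorem fourier_L2_eq_iff_eq_osc_int:
  fixes u h :: "real^'d \<Rightarrow> complex"
  assumes u: "continuous_on UNIV u" and h: "integrable lebesgue h" "h \<in> L2_space"
  shows "u \<in> L2_space \<and> (AE \<xi> in lebesgue. fourier_L2 u \<xi> = h \<xi>) \<longleftrightarrow> (\<forall>x. u x = osc_int h x)"
proof
  assume "u \<in> L2_space \<and> (AE \<xi> in lebesgue. fourier_L2 u \<xi> = h \<xi>)"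
  then have "AE x in lebesgue. u x = osc_int h x"
    using has_fourier_L2_inversion[OF has_fourier_L2_fourier_L2 h] by blast
  then have "AE x in lebesgue. x \<in> {x. u x = osc_int h x}"
    by simp
  moreover have "closed {x. u x = osc_int h x}"
    by (intro closed_Collect_eq u continuous_on_osc_int h)
  ultimately show "\<forall>x. u x = osc_int h x"
    using mem_closed_if_AE_lebesgue by blast
next
  assume "\<forall>x. u x = osc_int h x"
  then have "u = osc_int h"
    by auto
  then show "u \<in> L2_space \<and> (AE \<xi> in lebesgue. fourier_L2 u \<xi> = h \<xi>)"
    using osc_int_in_L2_space[OF h] has_fourier_L2_osc_int_unique[OF h] has_fourier_L2_fourier_L2 by blast
qed

section \<open>Damping on the dual cone\<close>

lemma integrable_exp_minus_abs:
  fixes c :: real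
  assumes c: "c > 0"
  shows "integrable lborel (\<lambda>x. exp (- c * \<bar>x\<bar>))"
proof -
  have "prob_space (density lborel (exponential_density c))"
    by (rule prob_space_exponential_density[OF c])
  then have "emeasure (density lborel (exponential_density c)) UNIV = 1"
    using prob_space.emeasure_space_1 by fastforce
  then have "(\<integral>\<^sup>+x. ennreal (exponential_density c x) \<partial>lborel) = 1"
    by (simp add: emeasure_density)
  moreover have "exponential_density c x \<ge> 0" for x
    using c by (auto simp: exponential_density_def)
  ultimately have e: "integrable lborel (exponential_density c)"
    by (intro integrableI_nonneg) auto
  from lborel_integrable_real_affine[OF this, of "-1" 0]
  have e': "integrable lborel (\<lambda>x. exponential_density c (- x))"
    by simp
  show ?thesis
  proof (rule Bochner_Integration.integrable_bound)
    show "integrable lborel (\<lambda>x. (1 / c) * (exponential_density c x + exponential_density c (- x)))"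
      by (intro integrable_mult_right Bochner_Integration.integrable_add e e')
    show "AE x in lborel. norm (exp (- c * \<bar>x\<bar>)) \<le> norm ((1 / c) * (exponential_density c x + exponential_density c (- x)))"
      using c by (auto simp: exponential_density_def abs_if mult.commute field_simps)
  qed measurable
qed

lemma integrable_exp_minus_norm:
  fixes c :: real
  assumes c: "c > 0"
  shows "integrable lebesgue (\<lambda>x::'a::euclidean_space. exp (- c * norm x))"
proof -
  define c' where "c' = c / DIM('a)"
  have c': "c' > 0"
    using c by (simp add: c'_def)
  have "integrable lborel (\<lambda>x::'a. \<Prod>b\<in>Basis. complex_of_real (exp (- c' * \<bar>x \<bullet> b\<bar>)))"
    by (rule integrable_prod_Basis) (use integrable_exp_minus_abs[OF c'] in \<open>simp add: integrable_of_real del: minus_mult_left\<close>)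
  moreover have "(\<lambda>x::'a. \<Prod>b\<in>Basis. complex_of_real (exp (- c' * \<bar>x \<bullet> b\<bar>))) \<in> borel_measurable lborel"
    by measurable
  ultimately have int: "integrable lebesgue (\<lambda>x::'a. \<Prod>b\<in>Basis. complex_of_real (exp (- c' * \<bar>x \<bullet> b\<bar>)))"
    using integrable_completion by blast
  show ?thesis
  proof (rule Bochner_Integration.integrable_bound[OF int])
    show "(\<lambda>x::'a. exp (- c * norm x)) \<in> borel_measurable lebesgue"
      by (intro measurable_completion) measurable
    have "exp (- c * norm x) \<le> (\<Prod>b\<in>Basis. exp (- c' * \<bar>x \<bullet> b\<bar>))" for x :: 'a
    proof -
      have "(\<Sum>b\<in>Basis. \<bar>x \<bullet> b\<bar>) \<le> DIM('a) * norm x"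
        using sum_bounded_above[of Basis "\<lambda>b. \<bar>x \<bullet> b\<bar>" "norm x"] Basis_le_norm[of _ x] by simp
      then have "c' * (\<Sum>b\<in>Basis. \<bar>x \<bullet> b\<bar>) \<le> c' * (DIM('a) * norm x)"
        using c' by (intro mult_left_mono) auto
      also have "\<dots> = c * norm x"
        by (simp add: c'_def)
      finally have "- c * norm x \<le> (\<Sum>b\<in>Basis. - c' * \<bar>x \<bullet> b\<bar>)"
        by (simp only: sum_distrib_left[symmetric])
      then show ?thesis
        by (simp only: exp_sum[OF finite_Basis, symmetric] exp_le_cancel_iff)
    qed
    then show "AE x::'a in lebesgue. norm (exp (- c * norm x)) \<le> norm (\<Prod>b\<in>Basis. complex_of_real (exp (- c' * \<bar>x \<bullet> b\<bar>)))"
      by (simp only: prod_norm[symmetric] norm_of_real abs_exp_cancel real_norm_def) simp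
  qed
qed

lemma closed_dual_cone: "closed (dual_cone \<Omega>)"
proof -
  have "dual_cone \<Omega> = (\<Inter>x\<in>\<Omega>. {\<xi>. 0 \<le> x \<bullet> \<xi>})"
    by (auto simp: dual_cone_def)
  then show ?thesis
    by (auto intro!: closed_INT closed_Collect_le continuous_intros)
qed

lemma dual_cone_sets_lebesgue [measurable, simp]: "dual_cone \<Omega> \<in> sets lebesgue"
  using closed_dual_cone[of \<Omega>] by (simp add: sets_completionI_sets)

text \<open>The cone contains with \<open>y\<close> also \<open>y - r \<xi> / |\<xi>|\<close> for some small \<open>r\<close>. Its pairing with \<open>\<xi>\<close> is nonnegative, which
  says \<open>r |\<xi>| \<le> \<langle>y,\<xi>\<rangle>\<close>.\<close>

lemma dual_cone_coercive:
  assumes y: "y \<in> \<Omega>" and "open \<Omega>"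
  obtains c where "c > 0" "\<And>\<xi>. \<xi> \<in> dual_cone \<Omega> \<Longrightarrow> c * norm \<xi> \<le> y \<bullet> \<xi>"
proof -
  obtain r where r: "r > 0" "cball y r \<subseteq> \<Omega>"
    using assms open_contains_cball by blast
  have "r * norm \<xi> \<le> y \<bullet> \<xi>" if \<xi>: "\<xi> \<in> dual_cone \<Omega>" for \<xi>
  proof (cases "\<xi> = 0")
    case False
    have "y - (r / norm \<xi>) *\<^sub>R \<xi> \<in> \<Omega>"
      using r False by (intro subsetD[OF r(2)]) (auto simp: dist_norm)
    then have "0 \<le> (y - (r / norm \<xi>) *\<^sub>R \<xi>) \<bullet> \<xi>"
      using \<xi> by (auto simp: dual_cone_def)
    also have "\<dots> = y \<bullet> \<xi> - r * norm \<xi>"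
      using False by (simp add: inner_diff_left dot_square_norm power2_eq_square)
    finally show ?thesis by simp
  qed simp
  with r(1) show ?thesis by (rule that)
qed

definition damped :: "(real^'d) set \<Rightarrow> (real^'d \<Rightarrow> complex) \<Rightarrow> real^'d \<Rightarrow> real^'d \<Rightarrow> complex" where
  "damped \<Omega> f y \<xi> = of_real (exp (- (y \<bullet> \<xi>))) * f \<xi> * indicator (dual_cone \<Omega>) \<xi>"

lemma L2_weight_square_integrable:
  assumes "f \<in> L2_weight \<Omega> \<rho> n"
  shows "f \<in> borel_measurable (lebesgue_on (dual_cone \<Omega>))"
    and "integrable (lebesgue_on (dual_cone \<Omega>)) (\<lambda>\<xi>. (cmod (f \<xi>))\<^sup>2)"
proof -
  show m[measurable]: "f \<in> borel_measurable (lebesgue_on (dual_cone \<Omega>))"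
    using assms by (simp add: L2_weight_def wL2_def)
  show "integrable (lebesgue_on (dual_cone \<Omega>)) (\<lambda>\<xi>. (cmod (f \<xi>))\<^sup>2)"
  proof (rule Bochner_Integration.integrable_bound)
    show "integrable (lebesgue_on (dual_cone \<Omega>)) (\<lambda>\<xi>. (cmod (f \<xi>))\<^sup>2 * sob_weight \<rho> n \<xi>)"
      using assms by (simp add: L2_weight_def wL2_def)
    have w: "sob_weight \<rho> n \<xi> \<ge> 1" for \<xi>
    proof -
      have "(\<rho> \<xi>) ^ (2 * 0) \<le> sob_weight \<rho> n \<xi>"
        unfolding sob_weight_def by (rule member_le_sum) (auto simp: power_mult)
      then show ?thesis by simp
    qed
    have "(cmod (f \<xi>))\<^sup>2 * 1 \<le> (cmod (f \<xi>))\<^sup>2 * \<bar>sob_weight \<rho> n \<xi>\<bar>" for \<xi>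
      using w[of \<xi>] by (intro mult_left_mono) auto
    then show "AE \<xi> in lebesgue_on (dual_cone \<Omega>). norm ((cmod (f \<xi>))\<^sup>2) \<le> norm ((cmod (f \<xi>))\<^sup>2 * sob_weight \<rho> n \<xi>)"
      by (auto simp: abs_mult)
  qed measurable
qed

text \<open>On the dual cone the factor \<open>exp (-\<langle>y,\<xi>\<rangle>)\<close> is bounded by \<open>1\<close> and by \<open>exp (-c |\<xi>|)\<close>. The first bound keeps
  square integrability; the second is square integrable, so the product with \<open>f\<close> is integrable.\<close>

lemma
  assumes f: "f \<in> borel_measurable (lebesgue_on (dual_cone \<Omega>))"
      "integrable (lebesgue_on (dual_cone \<Omega>)) (\<lambda>\<xi>. (cmod (f \<xi>))\<^sup>2)"
    and y: "y \<in> \<Omega>" and \<Omega>: "open \<Omega>"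
  shows integrable_damped: "integrable lebesgue (damped \<Omega> f y)"
    and damped_in_L2_space: "damped \<Omega> f y \<in> L2_space"
proof -
  obtain c where c: "c > 0" and coercive: "\<And>\<xi>. \<xi> \<in> dual_cone \<Omega> \<Longrightarrow> c * norm \<xi> \<le> y \<bullet> \<xi>"
    using dual_cone_coercive[OF y \<Omega>] by blast
  have "(\<lambda>\<xi>. if \<xi> \<in> dual_cone \<Omega> then f \<xi> else 0) \<in> borel_measurable lebesgue"
    using f(1) by (intro borel_measurable_if_I) auto
  moreover have "(\<lambda>\<xi>. complex_of_real (exp (- (y \<bullet> \<xi>)))) \<in> borel_measurable lebesgue"
    by (intro measurable_completion) measurable
  ultimately have "(\<lambda>\<xi>. complex_of_real (exp (- (y \<bullet> \<xi>))) * (if \<xi> \<in> dual_cone \<Omega> then f \<xi> else 0)) \<in> borel_measurable lebesgue"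
    by measurable
  moreover have "damped \<Omega> f y = (\<lambda>\<xi>. complex_of_real (exp (- (y \<bullet> \<xi>))) * (if \<xi> \<in> dual_cone \<Omega> then f \<xi> else 0))"
    by (auto simp: damped_def indicator_def)
  ultimately have m[measurable]: "damped \<Omega> f y \<in> borel_measurable lebesgue"
    by simp
  have f2: "integrable lebesgue (\<lambda>\<xi>. if \<xi> \<in> dual_cone \<Omega> then (cmod (f \<xi>))\<^sup>2 else 0)"
    using f(2) by (subst Lebesgue_Measure.integrable_restrict_UNIV) auto
  have bound: "exp (- (y \<bullet> \<xi>)) \<le> exp (- c * norm \<xi>)" "exp (- c * norm \<xi>) \<le> 1" if "\<xi> \<in> dual_cone \<Omega>" for \<xi>
    using coercive[OF that] c by auto
  show "damped \<Omega> f y \<in> L2_space"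
    unfolding mem_L2_space_iff
  proof (intro conjI m Bochner_Integration.integrable_bound[OF f2])
    have "exp (- (y \<bullet> \<xi>)) * cmod (f \<xi>) \<le> 1 * cmod (f \<xi>)" if "\<xi> \<in> dual_cone \<Omega>" for \<xi>
      by (intro mult_right_mono order_trans[OF bound(1) bound(2)] that) simp
    then have "(exp (- (y \<bullet> \<xi>)) * cmod (f \<xi>))\<^sup>2 \<le> (cmod (f \<xi>))\<^sup>2" if "\<xi> \<in> dual_cone \<Omega>" for \<xi>
      using that by (intro power_mono) auto
    then show "AE \<xi> in lebesgue. norm ((cmod (damped \<Omega> f y \<xi>))\<^sup>2) \<le> norm (if \<xi> \<in> dual_cone \<Omega> then (cmod (f \<xi>))\<^sup>2 else 0)"
      by (auto simp: damped_def norm_mult indicator_def)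
  qed measurable
  show "integrable lebesgue (damped \<Omega> f y)"
  proof (rule Bochner_Integration.integrable_bound)
    show "integrable lebesgue (\<lambda>\<xi>. (if \<xi> \<in> dual_cone \<Omega> then (cmod (f \<xi>))\<^sup>2 else 0) + exp (- (2 * c) * norm \<xi>))"
      by (intro Bochner_Integration.integrable_add f2 integrable_exp_minus_norm) (use c in simp)
    have "exp (- (y \<bullet> \<xi>)) * cmod (f \<xi>) \<le> (cmod (f \<xi>))\<^sup>2 + exp (- (2 * c) * norm \<xi>)" if "\<xi> \<in> dual_cone \<Omega>" for \<xi>
    proof -
      define p where "p = exp (- c * norm \<xi>)"
      have "exp (- (y \<bullet> \<xi>)) * cmod (f \<xi>) \<le> p * cmod (f \<xi>)"
        unfolding p_def by (intro mult_right_mono bound that) simp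
      also have "\<dots> \<le> (cmod (f \<xi>))\<^sup>2 + p\<^sup>2"
      proof -
        have "0 \<le> p * cmod (f \<xi>)"
          by (simp add: p_def)
        then show ?thesis
          using sum_squares_bound[of p "cmod (f \<xi>)"] by linarith
      qed
      also have "p\<^sup>2 = exp (- (2 * c) * norm \<xi>)"
        by (simp add: p_def power2_eq_square exp_add[symmetric])
      finally show ?thesis .
    qed
    then show "AE \<xi> in lebesgue. norm (damped \<Omega> f y \<xi>) \<le> norm ((if \<xi> \<in> dual_cone \<Omega> then (cmod (f \<xi>))\<^sup>2 else 0) + exp (- (2 * c) * norm \<xi>))"
      by (auto simp: damped_def norm_mult indicator_def)
  qed measurable
qed

text \<open>The link between the tube and Fourier analysis: the imaginary part of \<open>z\<close> becomes a damping factor.\<close>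

lemma laplace_eq_osc_int:
  "laplace \<Omega> f (cvec x y) = osc_int (damped \<Omega> f y) x"
proof -
  have "cpair (cvec x y) \<xi> = of_real (x \<bullet> \<xi>) + \<i> * of_real (y \<bullet> \<xi>)" for \<xi>
    unfolding cpair_def cvec_def inner_vec_def
    by (simp add: complex_eq_iff sum.distrib)
  then have "exp (\<i> * cpair (cvec x y) \<xi>) = of_real (exp (- (y \<bullet> \<xi>))) * exp (\<i> * of_real (x \<bullet> \<xi>))" for \<xi>
    by (simp add: exp_add[symmetric] exp_of_real[symmetric] algebra_simps)
  then have "indicat_real (dual_cone \<Omega>) \<xi> *\<^sub>R (exp (\<i> * cpair (cvec x y) \<xi>) * f \<xi>)
     = damped \<Omega> f y \<xi> * exp (\<i> * of_real (x \<bullet> \<xi>))" for \<xi>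
    by (simp add: damped_def indicator_def)
  then show ?thesis
    unfolding laplace_def osc_int_def
    by (subst Bochner_Integration.integral_restrict_space) simp_all
qed

lemma laplace_rep_iff:
  "laplace_rep \<Omega> F f \<longleftrightarrow> (\<forall>y\<in>\<Omega>. \<forall>x. slice F y x = osc_int (damped \<Omega> f y) x)"
  unfolding laplace_rep_def tube_def slice_def laplace_eq_osc_int[symmetric] by blast

lemma fourier_rep_iff:
  "fourier_rep \<Omega> F f \<longleftrightarrow> (\<forall>y\<in>\<Omega>. slice F y \<in> L2_space \<and>
     (AE \<xi> in lebesgue. fourier_L2 (slice F y) \<xi> = damped \<Omega> f y \<xi>))"
  by (simp add: fourier_rep_def damped_def)

lemma continuous_on_slice:
  assumes F: "holomorphic_several_on F (tube \<Omega>)" and y: "y \<in> \<Omega>"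
  shows "continuous_on UNIV (slice F y)"
proof -
  have "isCont F (cvec x y)" for x
  proof -
    have "cvec x y \<in> tube \<Omega>"
      using y by (auto simp: tube_def)
    then show ?thesis
      using F has_derivative_continuous unfolding holomorphic_several_on_def by blast
  qed
  moreover have "isCont (\<lambda>x. cvec x y) x" for x
    unfolding isCont_def cvec_def by (intro tendsto_intros tendsto_Complex)
  ultimately show ?thesis
    unfolding slice_def continuous_on_eq_continuous_at[OF open_UNIV]
    by (auto intro: isCont_o2[where f="\<lambda>x. cvec x y" and g=F])
qed

lemma AE_eq_if_damped_AE_eq:
  assumes "AE \<xi> in lebesgue. damped \<Omega> f y \<xi> = damped \<Omega> g y \<xi>"
  shows "AE \<xi> in lebesgue_on (dual_cone \<Omega>). g \<xi> = f \<xi>"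
proof -
  have "AE \<xi> in lebesgue. \<xi> \<in> dual_cone \<Omega> \<longrightarrow> g \<xi> = f \<xi>"
    using assms by eventually_elim (auto simp: damped_def)
  then show ?thesis
    by (subst AE_restrict_space_iff) auto
qed

section \<open>Equivalence of the representations\<close>

lemma laplace_rep_iff_fourier_rep:
  assumes cone: "regular_open_cone \<Omega>" and holo: "holomorphic_several_on F (tube \<Omega>)"
    and f: "f \<in> L2_weight \<Omega> \<rho> n"
  shows "laplace_rep \<Omega> F f \<longleftrightarrow> fourier_rep \<Omega> F f"
proof -
  have "open \<Omega>"
    using cone by (simp add: regular_open_cone_def)
  note d = integrable_damped[OF L2_weight_square_integrable[OF f] _ this]
    damped_in_L2_space[OF L2_weight_square_integrable[OF f] _ this]
  show ?thesis
    unfolding laplace_rep_iff fourier_rep_iff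
    using fourier_L2_eq_iff_eq_osc_int[OF continuous_on_slice[OF holo] d] by blast
qed

text \<open>One height \<open>y\<close> suffices, since the transform of that slice determines the damped function.\<close>

lemma laplace_rep_unique:
  assumes cone: "regular_open_cone \<Omega>" and holo: "holomorphic_several_on F (tube \<Omega>)"
    and f: "f \<in> L2_weight \<Omega> \<rho> n" "laplace_rep \<Omega> F f" and g: "g \<in> L2_weight \<Omega> \<rho> n" "laplace_rep \<Omega> F g"
  shows "AE \<xi> in lebesgue_on (dual_cone \<Omega>). g \<xi> = f \<xi>"
proof -
  obtain y where y: "y \<in> \<Omega>"
    using cone by (auto simp: regular_open_cone_def)
  have "AE \<xi> in lebesgue. fourier_L2 (slice F y) \<xi> = damped \<Omega> f y \<xi>"
      "AE \<xi> in lebesgue. fourier_L2 (slice F y) \<xi> = damped \<Omega> g y \<xi>"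
    using f g y laplace_rep_iff_fourier_rep[OF cone holo] unfolding fourier_rep_iff by blast+
  then have "AE \<xi> in lebesgue. damped \<Omega> f y \<xi> = damped \<Omega> g y \<xi>"
    by eventually_elim simp
  then show ?thesis
    by (rule AE_eq_if_damped_AE_eq)
qed

lemma hardy_sobolev_norm_eq:
  assumes cone: "regular_open_cone \<Omega>" and holo: "holomorphic_several_on F (tube \<Omega>)"
    and f: "f \<in> L2_weight \<Omega> \<rho> n" "laplace_rep \<Omega> F f"
  shows "hardy_sobolev_norm \<Omega> \<rho> n F = L2_weight_norm \<Omega> \<rho> n f"
proof -
  have "L2_weight_norm \<Omega> \<rho> n g = L2_weight_norm \<Omega> \<rho> n f"
    if g: "g \<in> L2_weight \<Omega> \<rho> n" "laplace_rep \<Omega> F g" for g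
  proof -
    have "(LINT \<xi>|lebesgue_on (dual_cone \<Omega>). (cmod (g \<xi>))\<^sup>2 * sob_weight \<rho> n \<xi>)
        = (LINT \<xi>|lebesgue_on (dual_cone \<Omega>). (cmod (f \<xi>))\<^sup>2 * sob_weight \<rho> n \<xi>)"
    proof (rule Bochner_Integration.integral_cong_AE)
      show "AE \<xi> in lebesgue_on (dual_cone \<Omega>). (cmod (g \<xi>))\<^sup>2 * sob_weight \<rho> n \<xi> = (cmod (f \<xi>))\<^sup>2 * sob_weight \<rho> n \<xi>"
        using laplace_rep_unique[OF cone holo f g] by eventually_elim simp
    qed (use f g in \<open>auto simp: L2_weight_def wL2_def\<close>)
    then show ?thesis
      by (simp add: L2_weight_norm_def wL2_norm_def)
  qed
  then have "{L2_weight_norm \<Omega> \<rho> n g | g. g \<in> L2_weight \<Omega> \<rho> n \<and> (\<forall>z\<in>tube \<Omega>. F z = laplace \<Omega> g z)}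
      = {L2_weight_norm \<Omega> \<rho> n f}"
    using f unfolding laplace_rep_def by blast
  then show ?thesis
    by (simp add: hardy_sobolev_norm_def)
qed

theorem theorem4p2:
  fixes \<Omega> :: "(real^'d) set"
    and \<rho> :: "real^'d \<Rightarrow> real"
    and n :: nat
    and F :: "complex^'d \<Rightarrow> complex"
  assumes cone: "regular_open_cone \<Omega>"
    and rho_cont: "continuous_on (dual_cone \<Omega>) \<rho>"
    and rho_nonneg: "\<And>\<xi>. \<xi> \<in> dual_cone \<Omega> \<Longrightarrow> \<rho> \<xi> \<ge> 0"
    and rho_pos: "\<And>\<xi>. \<xi> \<in> dual_cone \<Omega> \<Longrightarrow> \<xi> \<noteq> 0 \<Longrightarrow> \<rho> \<xi> > 0"
    and rho_homogeneous: "\<And>t \<xi>. t > 0 \<Longrightarrow> \<xi> \<in> dual_cone \<Omega> \<Longrightarrow> \<rho> (t *\<^sub>R \<xi>) = t * \<rho> \<xi>"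
    and holo: "holomorphic_several_on F (tube \<Omega>)"
  shows "(F \<in> hardy_sobolev \<Omega> \<rho> n \<longleftrightarrow>
            ex1_AE (lebesgue_on (dual_cone \<Omega>)) (L2_weight \<Omega> \<rho> n) (laplace_rep \<Omega> F)) \<and>
         (F \<in> hardy_sobolev \<Omega> \<rho> n \<longleftrightarrow>
            ex1_AE (lebesgue_on (dual_cone \<Omega>)) (L2_weight \<Omega> \<rho> n) (fourier_rep \<Omega> F)) \<and>
         (F \<in> hardy_sobolev \<Omega> \<rho> n \<longrightarrow>
            (\<forall>f\<in>L2_weight \<Omega> \<rho> n. laplace_rep \<Omega> F f \<or> fourier_rep \<Omega> F f \<longrightarrow>
               laplace_rep \<Omega> F f \<and> fourier_rep \<Omega> F f \<and>
               hardy_sobolev_norm \<Omega> \<rho> n F = L2_weight_norm \<Omega> \<rho> n f))"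
proof -
  have hardy: "F \<in> hardy_sobolev \<Omega> \<rho> n \<longleftrightarrow> (\<exists>f\<in>L2_weight \<Omega> \<rho> n. laplace_rep \<Omega> F f)"
    using holo by (simp add: hardy_sobolev_def laplace_rep_def)
  have iff: "laplace_rep \<Omega> F f \<longleftrightarrow> fourier_rep \<Omega> F f" if "f \<in> L2_weight \<Omega> \<rho> n" for f
    using laplace_rep_iff_fourier_rep[OF cone holo that] .
  have i_ii: "F \<in> hardy_sobolev \<Omega> \<rho> n \<longleftrightarrow>
      ex1_AE (lebesgue_on (dual_cone \<Omega>)) (L2_weight \<Omega> \<rho> n) (laplace_rep \<Omega> F)"
    unfolding hardy ex1_AE_def using laplace_rep_unique[OF cone holo] by blast
  moreover have "ex1_AE (lebesgue_on (dual_cone \<Omega>)) (L2_weight \<Omega> \<rho> n) (laplace_rep \<Omega> F) \<longleftrightarrow>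
      ex1_AE (lebesgue_on (dual_cone \<Omega>)) (L2_weight \<Omega> \<rho> n) (fourier_rep \<Omega> F)"
    unfolding ex1_AE_def using iff by blast
  ultimately show ?thesis
    using iff hardy_sobolev_norm_eq[OF cone holo] by blast
qed

end
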